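(* Let $W_1,\dots,W_k$ be subgroups of $S_d$ and let $\chi_m\colon W_m\to K$ be a one-dimensional character of $W_m$, $m=1,\dots,k$. The symmetric function in the countable set of variables $x_0,x_1,x_2,\dots$ $$ Z(\chi_1;p_1,\dots,p_d)\ast\cdots\ast Z(\chi_k;p_1,\dots,p_d) $$ is the weighted inventory of the set $$ U(\chi_1,\dots,\chi_k)=\coprod_{(\omega_1,\dots,\omega_k)\in T(W_1,\dots,W_k)}J\bigl(N_0^d,\psi_{(\omega_1,\dots,\omega_k)}\bigr), $$ that is, it equals the sum of the weights of all elements of $U(\chi_1,\dots,\chi_k)$.
   Context: $K$ is an algebraically closed field of characteristic zero; $d,k\ge1$; $S_d$ is the symmetric group; $N_0$ is the set of non-negative integers. A one-dimensional character of a group $W$ is a homomorphism $\chi\colon W\to K^*$. Let $I_m$ be a left transversal of $W_m$ in $S_d$. For each $m$, $s_m\colon S_d\to S(I_m)$ is the homomorphism determined by: $s_m(\zeta)(i)$ is the unique $j\in I_m$ with $j^{-1}\zeta i\in W_m$. The group $S_d$ acts on $I=I_1\times\cdots\times I_k$ by $s(\zeta)(i_1,\dots,i_k)=(s_1(\zeta)(i_1),\dots,s_k(\zeta)(i_k))$; the stabilizer of $(\omega_1,\dots,\omega_k)\in I$ is $\omega_1W_1\omega_1^{-1}\cap\cdots\cap\omega_kW_k\omega_k^{-1}$. $T(W_1,\dots,W_k)\subseteq I$ is a system of distinct representatives of the $S_d$-orbits in $I$, and $\psi_{(\omega_1,\dots,\omega_k)}$ is the one-dimensional character of this stabilizer which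 is the restriction of $\beta_\omega(\zeta)=\prod_{m=1}^k\chi_m\bigl((s_m(\zeta)(\omega_m))^{-1}\zeta\omega_m\bigr)$. A subgroup $W\le S_d$ acts on $N_0^d$ by permuting components. For a one-dimensional character $\psi$ of $W$, $J(N_0^d,\psi)$ is the set of those $W$-orbits in $N_0^d$ which contain the maximum number $|W:\mathrm{Ker}\,\psi|$ of $\mathrm{Ker}\,\psi$-orbits. The weight of the orbit of $(n_1,\dots,n_d)\in N_0^d$ is the monomial $x_{n_1}x_{n_2}\cdots x_{n_d}$; the weighted inventory of a set of orbits is the sum of the weights of its elements. For $W\le S_d$ and a one-dimensional character $\chi$ of $W$, $Z(\chi;p_1,\dots,p_d)=|W|^{-1}\sum_{\sigma\in W}\chi(\sigma)p_1^{c_1(\sigma)}\cdots p_d^{c_d(\sigma)}$, where $c_s(\sigma)$ is the number of cycles of length $s$ of $\sigma$ and $p_s=\sum_{i\ge0}x_i^s$. With $R^d$ the group of generalized characters of $S_d$, $\Lambda^d$ the group of homogeneous degree $d$ symmetric functions with integer coefficients in $x_0,x_1,\dots$, and $ch\colon R^d\to\Lambda^d$ the (bijective) characteristic map $ch(u)=\frac1{d!}\sum_{\sigma\in S_d}u(\sigma)p_1^{c_1(\sigma)}\cdots p_d^{c_d(\sigma)}$, one has $Z(\chi;p_1,\dots,p_d)=ch(\mathrm{ind}_W^{S_d}(\chi))$, and the internal product on $\Lambda^d$ is defined by $ch(u)\ast ch(v)=ch(uv)$. *)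

theory Defs
  imports
    "HOL-Algebra.Algebraic_Closure_Type"
    "HOL-Algebra.Group_Action"
    "HOL-Algebra.Sym_Groups"
    "HOL-Combinatorics.Orbits"
    "HOL-Library.Multiset"
    "Jordan_Normal_Form.Matrix"
begin

section \<open>Formal power series in countably many variables\<close>

text \<open>
  A series in $x_0, x_1, x_2, \dots$ is given by its coefficients. The monomial
  $x_{n_1} \cdots x_{n_d}$ is represented by the multiset with elements $n_1, \dots, n_d$,
  so that multiplication of monomials is addition of multisets.
\<close>

typedef 'a mseries = "UNIV :: (nat multiset \<Rightarrow> 'a) set"
  morphisms coeff_of Abs_mseries
  by simp

lemma coeff_of_Abs [simp]: "coeff_of (Abs_mseries f) = f"
  by (simp add: Abs_mseries_inverse)

lemma mseries_eqI: "(\<And>M. coeff_of f M = coeff_of g M) \<Longrightarrow> f = g"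
  by (metis coeff_of_inject ext)

lemma finite_submultisets: "finite {A. A \<subseteq># (M :: 'b multiset)}"
proof (induction M)
  case empty
  show ?case by simp
next
  case (add x M)
  have "{A. A \<subseteq># add_mset x M} \<subseteq> {A. A \<subseteq># M} \<union> add_mset x ` {A. A \<subseteq># M}"
  proof
    fix A assume A: "A \<in> {A. A \<subseteq># add_mset x M}"
    show "A \<in> {A. A \<subseteq># M} \<union> add_mset x ` {A. A \<subseteq># M}"
    proof (cases "x \<in># A")
      case True
      then obtain B where "A = add_mset x B" by (metis multi_member_split)
      with A show ?thesis by auto
    next
      case False
      have "count A y \<le> count M y" for y
        using A False mset_subset_eq_count[of A "add_mset x M" y]
        by (cases "y = x") (auto simp: not_in_iff)
      then have "A \<subseteq># M" by (rule mset_subset_eqI)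
      then show ?thesis by simp
    qed
  qed
  then show ?case using add.IH by (meson finite_UnI finite_imageI finite_subset)
qed

lemma double_diff_mset: "A \<subseteq># M \<Longrightarrow> M - (M - A) = (A :: 'b multiset)"
  by (simp add: multiset_eq_iff subseteq_mset_def)

lemma diff_diff_submset: "B \<subseteq># A \<Longrightarrow> M - B - (A - B) = M - (A :: 'b multiset)"
  by (simp add: multiset_eq_iff subseteq_mset_def)

instantiation mseries :: (comm_ring_1) comm_ring_1
begin

definition "0 = Abs_mseries (\<lambda>_. 0)"
definition "1 = Abs_mseries (\<lambda>M. if M = {#} then 1 else 0)"
definition "f + g = Abs_mseries (\<lambda>M. coeff_of f M + coeff_of g M)"
definition "f - g = Abs_mseries (\<lambda>M. coeff_of f M - coeff_of g M)"
definition "- f = Abs_mseries (\<lambda>M. - coeff_of f M)"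
definition "f * g = Abs_mseries (\<lambda>M. \<Sum>A | A \<subseteq># M. coeff_of f A * coeff_of g (M - A))"

instance
proof
  fix f g h :: "'a mseries"
  show "f + g + h = f + (g + h)" "f + g = g + f" "0 + f = f" "- f + f = 0" "f - g = f + - g"
    by (auto intro!: mseries_eqI simp: zero_mseries_def plus_mseries_def minus_mseries_def
        uminus_mseries_def)
  show "(0::'a mseries) \<noteq> 1"
  proof
    assume "(0::'a mseries) = 1"
    then have "coeff_of (0::'a mseries) {#} = coeff_of 1 {#}" by simp
    then show False by (simp add: zero_mseries_def one_mseries_def)
  qed
  show "(f + g) * h = f * h + g * h"
    by (auto intro!: mseries_eqI simp: plus_mseries_def times_mseries_def distrib_right sum.distrib)
  show "1 * f = f"
  proof (rule mseries_eqI)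
    fix M :: "nat multiset"
    have "(\<Sum>A | A \<subseteq># M. (if A = {#} then 1 else 0) * coeff_of f (M - A))
        = (\<Sum>A\<in>{{#}}. (if A = {#} then 1 else 0) * coeff_of f (M - A))"
      by (intro sum.mono_neutral_right finite_submultisets) auto
    then show "coeff_of (1 * f) M = coeff_of f M"
      by (simp add: times_mseries_def one_mseries_def)
  qed
  show "f * g = g * f"
  proof (rule mseries_eqI)
    fix M :: "nat multiset"
    have "(\<Sum>A | A \<subseteq># M. coeff_of f A * coeff_of g (M - A))
        = (\<Sum>A | A \<subseteq># M. coeff_of g A * coeff_of f (M - A))"
      by (rule sum.reindex_bij_witness[where i = "\<lambda>A. M - A" and j = "\<lambda>A. M - A"])
        (auto simp: mult.commute double_diff_mset)
    then show "coeff_of (f * g) M = coeff_of (g * f) M"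
      by (simp add: times_mseries_def)
  qed
  show "f * g * h = f * (g * h)"
  proof (rule mseries_eqI)
    fix M :: "nat multiset"
    let ?t = "\<lambda>A B C. coeff_of f A * coeff_of g B * coeff_of h C"
    have "coeff_of (f * g * h) M
        = (\<Sum>(A, B)\<in>(SIGMA A:{A. A \<subseteq># M}. {B. B \<subseteq># A}). ?t B (A - B) (M - A))"
      by (simp add: times_mseries_def sum_distrib_right sum.Sigma finite_submultisets)
    also have "\<dots> = (\<Sum>(B, C)\<in>(SIGMA B:{B. B \<subseteq># M}. {C. C \<subseteq># M - B}). ?t B C (M - B - C))"
    proof (rule sum.reindex_bij_witness[where i = "\<lambda>(B, C). (B + C, B)"
          and j = "\<lambda>(A, B). (B, A - B)"])
      fix p assume "p \<in> (SIGMA A:{A. A \<subseteq># M}. {B. B \<subseteq># A})"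
      then obtain A B where p: "p = (A, B)" "A \<subseteq># M" "B \<subseteq># A" by auto
      show "(\<lambda>(B, C). (B + C, B)) ((\<lambda>(A, B). (B, A - B)) p) = p"
        using p by simp
      show "(\<lambda>(A, B). (B, A - B)) p \<in> (SIGMA B:{B. B \<subseteq># M}. {C. C \<subseteq># M - B})"
        using p by (auto simp: subseteq_mset_def diff_le_mono) (meson order_trans)
      have "M - B - (A - B) = M - A"
        using p by (simp add: diff_diff_submset)
      then show "(case (\<lambda>(A, B). (B, A - B)) p of (B, C) \<Rightarrow> ?t B C (M - B - C))
          = (case p of (A, B) \<Rightarrow> ?t B (A - B) (M - A))"
        using p by simp
    next
      fix p assume "p \<in> (SIGMA B:{B. B \<subseteq># M}. {C. C \<subseteq># M - B})"
      then obtain B C where p: "p = (B, C)" "B \<subseteq># M" "C \<subseteq># M - B" by auto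
      show "(\<lambda>(A, B). (B, A - B)) ((\<lambda>(B, C). (B + C, B)) p) = p"
        using p by simp
      have "B + C \<subseteq># M"
        using p by (metis subset_mset.add_diff_inverse mset_subset_eq_mono_add_left_cancel)
      then show "(\<lambda>(B, C). (B + C, B)) p \<in> (SIGMA A:{A. A \<subseteq># M}. {B. B \<subseteq># A})"
        using p by simp
    qed
    also have "\<dots> = coeff_of (f * (g * h)) M"
      by (simp add: times_mseries_def sum_distrib_left sum.Sigma finite_submultisets mult.assoc)
    finally show "coeff_of (f * g * h) M = coeff_of (f * (g * h)) M" .
  qed
qed

end

definition smult_series :: "'a::comm_ring_1 \<Rightarrow> 'a mseries \<Rightarrow> 'a mseries" where
  "smult_series c f = Abs_mseries (\<lambda>M. c * coeff_of f M)"

definition var :: "nat \<Rightarrow> 'a::comm_ring_1 mseries" where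
  "var i = Abs_mseries (\<lambda>M. if M = {#i#} then 1 else 0)"

text \<open>
  The formal sum of a possibly infinite family of series is taken coefficientwise. It is
  meaningful for locally finite families, in which every monomial occurs in only finitely
  many members. The families summed below are locally finite: the powers $x_i^s$ with
  $s \ge 1$, and the weights of orbits in $N_0^d$.
\<close>

definition formal_sum :: "('b \<Rightarrow> 'a::comm_ring_1 mseries) \<Rightarrow> 'b set \<Rightarrow> 'a mseries" where
  "formal_sum w S = Abs_mseries (\<lambda>M. \<Sum>a | a \<in> S \<and> coeff_of (w a) M \<noteq> 0. coeff_of (w a) M)"

definition power_sum :: "nat \<Rightarrow> 'a::comm_ring_1 mseries" where
  "power_sum s = formal_sum (\<lambda>i. var i ^ s) UNIV"


section \<open>Generalized characters, the characteristic map and the internal product\<close>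

definition mult_group :: "'k::field monoid" where
  "mult_group = units_of ring_of_type_algebra"

definition one_dim_char ::
    "nat \<Rightarrow> (nat \<Rightarrow> nat) set \<Rightarrow> ((nat \<Rightarrow> nat) \<Rightarrow> 'k::field) \<Rightarrow> bool" where
  "one_dim_char d W \<chi> \<longleftrightarrow> \<chi> \<in> hom (sym_group d\<lparr>carrier := W\<rparr>) mult_group"

text \<open>The orbit of \<open>i\<close> under iteration of \<open>\<sigma>\<close> is the cycle through \<open>i\<close>;
  fixed points are the cycles of length 1.\<close>

definition cycle_count :: "nat \<Rightarrow> (nat \<Rightarrow> nat) \<Rightarrow> nat \<Rightarrow> nat" where
  "cycle_count d \<sigma> s = card {C \<in> Orbits.orbit \<sigma> ` {1..d}. card C = s}"

definition cycle_index ::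
    "nat \<Rightarrow> (nat \<Rightarrow> nat) set \<Rightarrow> ((nat \<Rightarrow> nat) \<Rightarrow> 'k::field) \<Rightarrow> (nat \<Rightarrow> 'k mseries) \<Rightarrow> 'k mseries"
  where
  "cycle_index d W \<chi> p = smult_series (1 / of_nat (card W))
     (\<Sum>\<sigma>\<in>W. smult_series (\<chi> \<sigma>) (\<Prod>s = 1..d. p s ^ cycle_count d \<sigma> s))"

definition mat_trace :: "'a::comm_monoid_add mat \<Rightarrow> 'a" where
  "mat_trace A = (\<Sum>i<dim_row A. A $$ (i, i))"

text \<open>Characters are extensional functions on \<open>S\<^sub>d\<close>, so that the characteristic map is
  injective on generalized characters.\<close>

definition characters :: "nat \<Rightarrow> ((nat \<Rightarrow> nat) \<Rightarrow> 'k::field) set" where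
  "characters d = {(\<lambda>\<sigma>\<in>carrier (sym_group d). mat_trace (\<rho> \<sigma>)) | \<rho> n.
     \<rho> \<in> hom (sym_group d) (units_of (ring_mat TYPE('k) n ()))}"

definition gen_characters :: "nat \<Rightarrow> ((nat \<Rightarrow> nat) \<Rightarrow> 'k::field) set" where
  "gen_characters d = {(\<lambda>\<sigma>\<in>carrier (sym_group d). u \<sigma> - v \<sigma>) | u v.
     u \<in> characters d \<and> v \<in> characters d}"

definition ch :: "nat \<Rightarrow> ((nat \<Rightarrow> nat) \<Rightarrow> 'k::field) \<Rightarrow> 'k mseries" where
  "ch d u = smult_series (1 / of_nat (fact d))
     (\<Sum>\<sigma>\<in>carrier (sym_group d). smult_series (u \<sigma>) (\<Prod>s = 1..d. power_sum s ^ cycle_count d \<sigma> s))"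

text \<open>
  \<open>ch\<close> is a bijection from the generalized characters of \<open>S\<^sub>d\<close> onto the symmetric functions that
  are homogeneous of degree \<open>d\<close> and have integer coefficients (regarded as elements of \<open>K\<close>).
  The internal product is multiplication of characters transported along this bijection.
\<close>

definition internal_prod :: "nat \<Rightarrow> 'k::field mseries \<Rightarrow> 'k mseries \<Rightarrow> 'k mseries" where
  "internal_prod d f g =
     (let u = the_inv_into (gen_characters d) (ch d) f;
          v = the_inv_into (gen_characters d) (ch d) g
      in ch d (\<lambda>\<sigma>\<in>carrier (sym_group d). u \<sigma> * v \<sigma>))"


section \<open>Orbits of tuples\<close>

definition tuples :: "nat \<Rightarrow> (nat \<Rightarrow> nat) set" where
  "tuples d = {1..d} \<rightarrow>\<^sub>E (UNIV :: nat set)"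

definition perm_act :: "nat \<Rightarrow> (nat \<Rightarrow> nat) \<Rightarrow> (nat \<Rightarrow> nat) \<Rightarrow> (nat \<Rightarrow> nat)" where
  "perm_act d \<sigma> = (\<lambda>n\<in>tuples d. \<lambda>i\<in>{1..d}. n ((inv\<^bsub>sym_group d\<^esub> \<sigma>) i))"

definition tuple_orbits :: "nat \<Rightarrow> (nat \<Rightarrow> nat) set \<Rightarrow> (nat \<Rightarrow> nat) set set" where
  "tuple_orbits d W = orbits (sym_group d\<lparr>carrier := W\<rparr>) (tuples d) (perm_act d)"

definition J_orbits :: "nat \<Rightarrow> (nat \<Rightarrow> nat) set \<Rightarrow> ((nat \<Rightarrow> nat) \<Rightarrow> 'k::field) \<Rightarrow> (nat \<Rightarrow> nat) set set" where
  "J_orbits d W \<psi> =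
     (let G = sym_group d\<lparr>carrier := W\<rparr>; Ker = kernel G mult_group \<psi>
      in {Q \<in> tuple_orbits d W. card {P \<in> tuple_orbits d Ker. P \<subseteq> Q} = card (rcosets\<^bsub>G\<^esub> Ker)})"

text \<open>All tuples in an orbit give the same monomial, hence the image below is a singleton.\<close>

definition orbit_weight :: "nat \<Rightarrow> (nat \<Rightarrow> nat) set \<Rightarrow> 'k::field mseries" where
  "orbit_weight d Q = the_elem ((\<lambda>n. \<Prod>i = 1..d. var (n i)) ` Q)"


section \<open>The action on products of transversals\<close>

definition left_transversal :: "nat \<Rightarrow> (nat \<Rightarrow> nat) set \<Rightarrow> (nat \<Rightarrow> nat) set \<Rightarrow> bool" where
  "left_transversal d W I \<longleftrightarrow> I \<subseteq> carrier (sym_group d) \<and>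
     (\<forall>\<zeta>\<in>carrier (sym_group d). \<exists>!i. i \<in> I \<and> i \<in> \<zeta> <#\<^bsub>sym_group d\<^esub> W)"

definition coset_act ::
    "nat \<Rightarrow> (nat \<Rightarrow> nat) set \<Rightarrow> (nat \<Rightarrow> nat) set \<Rightarrow> (nat \<Rightarrow> nat) \<Rightarrow> (nat \<Rightarrow> nat) \<Rightarrow> (nat \<Rightarrow> nat)" where
  "coset_act d W I \<zeta> = (\<lambda>i\<in>I. THE j. j \<in> I \<and>
     inv\<^bsub>sym_group d\<^esub> j \<otimes>\<^bsub>sym_group d\<^esub> \<zeta> \<otimes>\<^bsub>sym_group d\<^esub> i \<in> W)"

definition coset_tuples :: "nat \<Rightarrow> (nat \<Rightarrow> (nat \<Rightarrow> nat) set) \<Rightarrow> (nat \<Rightarrow> nat \<Rightarrow> nat) set" where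
  "coset_tuples k I = (\<Pi>\<^sub>E m\<in>{1..k}. I m)"

definition coset_tuple_act ::
    "nat \<Rightarrow> nat \<Rightarrow> (nat \<Rightarrow> (nat \<Rightarrow> nat) set) \<Rightarrow> (nat \<Rightarrow> (nat \<Rightarrow> nat) set) \<Rightarrow>
     (nat \<Rightarrow> nat) \<Rightarrow> (nat \<Rightarrow> nat \<Rightarrow> nat) \<Rightarrow> (nat \<Rightarrow> nat \<Rightarrow> nat)" where
  "coset_tuple_act d k W I \<zeta> =
     (\<lambda>\<omega>\<in>coset_tuples k I. \<lambda>m\<in>{1..k}. coset_act d (W m) (I m) \<zeta> (\<omega> m))"

definition orbit_representatives ::
    "nat \<Rightarrow> nat \<Rightarrow> (nat \<Rightarrow> (nat \<Rightarrow> nat) set) \<Rightarrow> (nat \<Rightarrow> (nat \<Rightarrow> nat) set) \<Rightarrow>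
     (nat \<Rightarrow> nat \<Rightarrow> nat) set \<Rightarrow> bool" where
  "orbit_representatives d k W I T \<longleftrightarrow> T \<subseteq> coset_tuples k I \<and>
     (\<forall>Q\<in>orbits (sym_group d) (coset_tuples k I) (coset_tuple_act d k W I). \<exists>!\<omega>. \<omega> \<in> T \<and> \<omega> \<in> Q)"

definition stab ::
    "nat \<Rightarrow> nat \<Rightarrow> (nat \<Rightarrow> (nat \<Rightarrow> nat) set) \<Rightarrow> (nat \<Rightarrow> (nat \<Rightarrow> nat) set) \<Rightarrow>
     (nat \<Rightarrow> nat \<Rightarrow> nat) \<Rightarrow> (nat \<Rightarrow> nat) set" where
  "stab d k W I \<omega> = stabilizer (sym_group d) (coset_tuple_act d k W I) \<omega>"

definition beta ::
    "nat \<Rightarrow> nat \<Rightarrow> (nat \<Rightarrow> (nat \<Rightarrow> nat) set) \<Rightarrow> (nat \<Rightarrow> (nat \<Rightarrow> nat) set) \<Rightarrow>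
     (nat \<Rightarrow> (nat \<Rightarrow> nat) \<Rightarrow> 'k::field) \<Rightarrow> (nat \<Rightarrow> nat \<Rightarrow> nat) \<Rightarrow> (nat \<Rightarrow> nat) \<Rightarrow> 'k" where
  "beta d k W I \<chi> \<omega> \<zeta> = (\<Prod>m = 1..k. \<chi> m
     (inv\<^bsub>sym_group d\<^esub> (coset_act d (W m) (I m) \<zeta> (\<omega> m)) \<otimes>\<^bsub>sym_group d\<^esub> \<zeta> \<otimes>\<^bsub>sym_group d\<^esub> \<omega> m))"

definition psi ::
    "nat \<Rightarrow> nat \<Rightarrow> (nat \<Rightarrow> (nat \<Rightarrow> nat) set) \<Rightarrow> (nat \<Rightarrow> (nat \<Rightarrow> nat) set) \<Rightarrow>
     (nat \<Rightarrow> (nat \<Rightarrow> nat) \<Rightarrow> 'k::field) \<Rightarrow> (nat \<Rightarrow> nat \<Rightarrow> nat) \<Rightarrow> (nat \<Rightarrow> nat) \<Rightarrow> 'k" where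
  "psi d k W I \<chi> \<omega> = restrict (beta d k W I \<chi> \<omega>) (stab d k W I \<omega>)"

definition U_set ::
    "nat \<Rightarrow> nat \<Rightarrow> (nat \<Rightarrow> (nat \<Rightarrow> nat) set) \<Rightarrow> (nat \<Rightarrow> (nat \<Rightarrow> nat) set) \<Rightarrow>
     (nat \<Rightarrow> (nat \<Rightarrow> nat) \<Rightarrow> 'k::field) \<Rightarrow> (nat \<Rightarrow> nat \<Rightarrow> nat) set \<Rightarrow>
     ((nat \<Rightarrow> nat \<Rightarrow> nat) \<times> (nat \<Rightarrow> nat) set) set" where
  "U_set d k W I \<chi> T = (SIGMA \<omega>:T. J_orbits d (stab d k W I \<omega>) (psi d k W I \<chi> \<omega>))"

definition weighted_inventory ::
    "nat \<Rightarrow> ((nat \<Rightarrow> nat \<Rightarrow> nat) \<times> (nat \<Rightarrow> nat) set) set \<Rightarrow> 'k::field mseries" where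
  "weighted_inventory d S = formal_sum (\<lambda>(\<omega>, Q). orbit_weight d Q) S"

end

theory Submission
  imports Defs
begin

text \<open>
  Inducing \<open>\<chi>\<^sub>m\<close> from \<open>W\<^sub>m\<close> gives a monomial representation of $S_d$ on the points of \<open>I\<^sub>m\<close>, and a
  product of monomial representations is the monomial representation on the product of the
  point sets whose cocycle is the product of the cocycles; for the \<open>I\<^sub>m\<close> this cocycle is \<open>\<beta>\<close>.
  Sorting the fixed points of a monomial representation by orbits shows that \<open>ch\<close> of its
  character is the sum, over orbit representatives \<open>\<omega>\<close>, of the cycle indices of the stabilizers
  with the characters \<open>\<psi>\<^sub>\<omega>\<close>.

  The coefficient at a monomial \<open>M\<close> of the power sum product attached to \<open>\<sigma>\<close> counts the tuples of
  weight \<open>M\<close> fixed by \<open>\<sigma>\<close>. Hence the coefficient of a cycle index is a Burnside-type sum, in which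
  a tuple contributes only if \<open>\<psi>\<close> is trivial on its stabilizer; by orbit counting under \<open>Ker \<psi>\<close>
  these are exactly the tuples whose orbit belongs to \<open>J\<close>.

  The internal product is defined through the inverse of \<open>ch\<close>, so the injectivity of \<open>ch\<close> on
  generalized characters is needed as well. If $u \neq v$, choose \<open>\<sigma>\<close> with the maximal number of
  cycles among the permutations where they differ. Among these permutations, only conjugates of
  \<open>\<sigma>\<close> fix a tuple with the weight of a tuple that separates the cycles of \<open>\<sigma>\<close>, so this weight
  has a nonzero coefficient in $ch(u) - ch(v)$.
\<close>

section \<open>Coefficients of products of power sums\<close>

lemma coeff_zero [simp]: "coeff_of 0 M = 0"
  and coeff_one: "coeff_of 1 M = (if M = {#} then 1 else 0)"
  and coeff_add [simp]: "coeff_of (f + g) M = coeff_of f M + coeff_of g M"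
  and coeff_mult: "coeff_of (f * g) M = (\<Sum>A | A \<subseteq># M. coeff_of f A * coeff_of g (M - A))"
  and coeff_smult [simp]: "coeff_of (smult_series c f) M = c * coeff_of f M"
  by (simp_all add: zero_mseries_def one_mseries_def plus_mseries_def times_mseries_def
      smult_series_def)

lemma coeff_sum [simp]: "coeff_of (\<Sum>x\<in>S. f x) M = (\<Sum>x\<in>S. coeff_of (f x) M)"
  by (induction S rule: infinite_finite_induct) auto

definition monomial :: "nat multiset \<Rightarrow> 'a::comm_ring_1 mseries" where
  "monomial A = Abs_mseries (\<lambda>M. if M = A then 1 else 0)"

lemma coeff_monomial: "coeff_of (monomial A) M = (if M = A then 1 else 0)"
  by (simp add: monomial_def)

lemma var_eq_monomial: "var i = monomial {#i#}"
  by (simp add: var_def monomial_def)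

lemma monomial_empty: "monomial {#} = 1"
  by (simp add: monomial_def one_mseries_def)

lemma monomial_mult: "(monomial A :: 'a::comm_ring_1 mseries) * monomial B = monomial (A + B)"
proof (rule mseries_eqI)
  fix M
  have "coeff_of ((monomial A :: 'a mseries) * monomial B) M
      = (\<Sum>C | C \<subseteq># M. if C = A then (if M - A = B then 1 else 0) else 0)"
    unfolding coeff_mult by (rule sum.cong) (auto simp: coeff_monomial)
  also have "\<dots> = (if A \<subseteq># M \<and> M - A = B then 1 else 0)"
    by (simp add: sum.delta finite_submultisets)
  also have "(A \<subseteq># M \<and> M - A = B) \<longleftrightarrow> M = A + B"
    by auto
  finally show "coeff_of ((monomial A :: 'a mseries) * monomial B) M = coeff_of (monomial (A + B)) M"
    by (simp add: coeff_monomial)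
qed

lemma prod_var: "finite S \<Longrightarrow> (\<Prod>i\<in>S. var (n i)) = monomial (image_mset n (mset_set S))"
  by (induction S rule: finite_induct)
    (simp_all add: monomial_empty var_eq_monomial monomial_mult)

lemma var_power: "var i ^ s = monomial (replicate_mset s i)"
  by (induction s) (simp_all add: monomial_empty var_eq_monomial monomial_mult)

text \<open>For \<open>s \<ge> 1\<close> different variables have different \<open>s\<close>-th
  powers, so at most one member of the family contributes to a given coefficient. For
  \<open>s = 0\<close> every member would be 1 and the family would not be locally finite.\<close>

lemma coeff_power_sum:
  assumes "s \<ge> 1"
  shows "coeff_of (power_sum s :: 'a::comm_ring_1 mseries) M
    = (if \<exists>i. M = replicate_mset s i then 1 else 0)"
proof (cases "\<exists>i. M = replicate_mset s i")
  case True
  then obtain i where i: "M = replicate_mset s i" by blast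
  have "replicate_mset s i = replicate_mset s j \<longleftrightarrow> j = i" for j
    using assms by (metis count_replicate_mset not_one_le_zero)
  then have "{a \<in> UNIV. coeff_of (var a ^ s :: 'a mseries) M \<noteq> 0} = {i}"
    by (auto simp: var_power coeff_monomial i)
  with True i show ?thesis
    by (simp add: power_sum_def formal_sum_def var_power coeff_monomial)
next
  case False
  then show ?thesis
    by (auto simp: power_sum_def formal_sum_def var_power coeff_monomial)
qed

section \<open>Products of power sums and block colourings\<close>

definition block_colourings :: "'b set set \<Rightarrow> nat multiset \<Rightarrow> ('b \<Rightarrow> nat) set" where
  "block_colourings S M = {n \<in> \<Union>S \<rightarrow>\<^sub>E UNIV.
     (\<forall>C\<in>S. \<forall>x\<in>C. \<forall>y\<in>C. n x = n y) \<and> image_mset n (mset_set (\<Union>S)) = M}"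

lemma finite_tuples_mset:
  assumes "finite D"
  shows "finite {n \<in> D \<rightarrow>\<^sub>E UNIV. image_mset n (mset_set D) = (M :: 'c multiset)}"
proof (rule finite_subset)
  show "{n \<in> D \<rightarrow>\<^sub>E UNIV. image_mset n (mset_set D) = M} \<subseteq> D \<rightarrow>\<^sub>E set_mset M"
    using assms by (auto simp: PiE_def)
  show "finite (D \<rightarrow>\<^sub>E set_mset M)"
    using assms by (intro finite_PiE) auto
qed

lemma finite_block_colourings:
  "finite (\<Union>S) \<Longrightarrow> finite (block_colourings S M)"
  unfolding block_colourings_def
  by (rule finite_subset[OF _ finite_tuples_mset[of "\<Union>S" M]]) auto

lemma image_mset_const:
  assumes "finite C" "\<And>y. y \<in> C \<Longrightarrow> n y = i"
  shows "image_mset n (mset_set C) = replicate_mset (card C) i"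
proof -
  have "image_mset n (mset_set C) = image_mset (\<lambda>_. i) (mset_set C)"
    using assms by (intro image_mset_cong) auto
  then show ?thesis by (simp add: image_mset_const_eq)
qed

text \<open>Multiplying out means choosing one term \<open>x_i ^ card C\<close> for each block
  \<open>C\<close>, that is, one colour per block; the choices with product \<open>M\<close> are the
  block colourings of weight \<open>M\<close>. The induction splits off one block: colouring it
  \<open>i\<close> leaves the weight \<open>M\<close> minus \<open>card C\<close> copies of
  \<open>i\<close> for the others. Blocks are nonempty so that their power sums have positive
  exponent.\<close>

lemma coeff_prod_power_sum:
  assumes "finite S" "\<And>C. C \<in> S \<Longrightarrow> finite C \<and> C \<noteq> {}" "disjoint S"
  shows "coeff_of (\<Prod>C\<in>S. power_sum (card C) :: 'a::comm_ring_1 mseries) M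
    = of_nat (card (block_colourings S M))"
  using assms
proof (induction S arbitrary: M rule: finite_induct)
  case empty
  have "block_colourings ({} :: 'b set set) M = (if M = {#} then {\<lambda>_. undefined} else {})"
    by (auto simp: block_colourings_def)
  then show ?case by (simp add: coeff_one)
next
  case (insert C S)
  define U where "U = \<Union>S"
  have C: "finite C" "C \<noteq> {}" and U: "finite U"
    using insert.prems(1) insert.hyps(1) by (auto simp: U_def)
  have disj: "x \<notin> C" if "x \<in> U" for x
    using insert.prems(2) insert.hyps(2) that by (force simp: disjoint_def U_def)
  have card_C: "card C \<ge> 1" using C by (simp add: Suc_leI card_gt_0_iff)
  obtain c where c: "c \<in> C" using C by blast
  have Un: "\<Union>(insert C S) = C \<union> U" by (simp add: U_def)
  have mset_Un: "mset_set (C \<union> U) = mset_set C + mset_set U"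
    using C U disj by (intro mset_set_Union) auto
  have IH: "coeff_of (\<Prod>C\<in>S. power_sum (card C) :: 'a mseries) M
      = of_nat (card (block_colourings S M))" for M
    using insert.prems by (intro insert.IH) (auto simp: disjoint_def)
  let ?r = "replicate_mset (card C) :: nat \<Rightarrow> nat multiset"
  have inj_r: "inj ?r"
    using card_C by (intro injI) (metis count_replicate_mset not_one_le_zero)
  \<comment> \<open>The admissible colours of the block \<open>C\<close>: those for which
    \<open>x_i ^ card C\<close> divides \<open>M\<close>. They index the nonzero terms of the
    convolution.\<close>
  define R where "R = {i. ?r i \<subseteq># M}"
  have "finite (?r ` R)"
    by (rule finite_subset[OF _ finite_submultisets[of M]]) (auto simp: R_def)
  then have fin_R: "finite R"
    using inj_r by (meson finite_imageD inj_on_subset subset_UNIV)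
  have "coeff_of (\<Prod>C\<in>insert C S. power_sum (card C) :: 'a mseries) M
     = (\<Sum>A | A \<subseteq># M. coeff_of (power_sum (card C) :: 'a mseries) A
          * of_nat (card (block_colourings S (M - A))))"
    by (simp only: prod.insert[OF insert(1,2)] coeff_mult IH)
  also have "\<dots> = (\<Sum>A\<in>?r ` R. of_nat (card (block_colourings S (M - A))))"
    by (rule sum.mono_neutral_cong_right)
      (auto simp: finite_submultisets R_def coeff_power_sum[OF card_C])
  also have "\<dots> = (\<Sum>i\<in>R. of_nat (card (block_colourings S (M - ?r i))))"
    using inj_r by (subst sum.reindex) (auto intro: inj_on_subset)
  also have "\<dots> = of_nat (card (SIGMA i:R. block_colourings S (M - ?r i)))"
    using U by (subst card_SigmaI) (auto simp: fin_R finite_block_colourings U_def)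
  also have "card (SIGMA i:R. block_colourings S (M - ?r i)) = card (block_colourings (insert C S) M)"
  proof (rule bij_betw_same_card, rule bij_betw_byWitness)
    \<comment> \<open>\<open>f\<close> glues a colour for \<open>C\<close> to a colouring of the
      remaining blocks; \<open>g\<close> reads the colour of \<open>C\<close> off at the chosen
      point \<open>c\<close> and restricts to the rest.\<close>
    define f where "f = (\<lambda>(i, n) x. if x \<in> C then i else n x :: nat)"
    define g where "g = (\<lambda>n :: 'b \<Rightarrow> nat. (n c, restrict n U))"
    show "\<forall>p\<in>SIGMA i:R. block_colourings S (M - ?r i). g (f p) = p"
    proof
      fix p assume "p \<in> (SIGMA i:R. block_colourings S (M - ?r i))"
      then obtain i n where p: "p = (i, n)" and n: "n \<in> U \<rightarrow>\<^sub>E UNIV"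
        by (auto simp: block_colourings_def U_def)
      have "restrict (f (i, n)) U x = n x" for x
        using PiE_arb[OF n, of x] disj[of x] by (cases "x \<in> U") (simp_all add: f_def)
      then show "g (f p) = p" using c by (simp add: p g_def f_def fun_eq_iff)
    qed
    show "\<forall>n\<in>block_colourings (insert C S) M. f (g n) = n"
    proof
      fix n assume n: "n \<in> block_colourings (insert C S) M"
      then have dom: "n \<in> C \<union> U \<rightarrow>\<^sub>E UNIV" and const: "\<And>x. x \<in> C \<Longrightarrow> n x = n c"
        using c unfolding block_colourings_def Un by blast+
      have "f (g n) x = n x" for x
        using const[of x] PiE_arb[OF dom, of x] by (auto simp: f_def g_def restrict_def)
      then show "f (g n) = n" by (rule ext)
    qed
    show "f ` (SIGMA i:R. block_colourings S (M - ?r i)) \<subseteq> block_colourings (insert C S) M"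
    proof
      fix n' assume "n' \<in> f ` (SIGMA i:R. block_colourings S (M - ?r i))"
      then obtain i n where i: "?r i \<subseteq># M" and n: "n \<in> block_colourings S (M - ?r i)"
        and n': "n' = f (i, n)"
        by (auto simp: R_def)
      have eq: "n' x = i" if "x \<in> C" for x using that by (simp add: n' f_def)
      have eq': "n' x = n x" if "x \<in> U" for x using disj[OF that] by (simp add: n' f_def)
      have "image_mset n' (mset_set C) = ?r i"
        using C(1) eq by (rule image_mset_const)
      moreover have "image_mset n' (mset_set U) = image_mset n (mset_set U)"
        using U eq' by (intro image_mset_cong) auto
      ultimately have "image_mset n' (mset_set (C \<union> U)) = M"
        using n i by (simp add: mset_Un block_colourings_def flip: U_def)
      moreover have "n' x = undefined" if "x \<notin> C \<union> U" for x
        using n that PiE_arb[of n U "\<lambda>_. UNIV" x]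
        by (auto simp: n' f_def block_colourings_def U_def)
      then have "n' \<in> C \<union> U \<rightarrow>\<^sub>E UNIV" by auto
      moreover have "n' x = n' y" if D: "D \<in> insert C S" "x \<in> D" "y \<in> D" for D x y
      proof (cases "D = C")
        case True
        then show ?thesis using D eq by metis
      next
        case False
        then have "D \<in> S" "x \<in> U" "y \<in> U" using D by (auto simp: U_def)
        then have "n x = n y" using D n unfolding block_colourings_def by blast
        then show ?thesis using eq' \<open>x \<in> U\<close> \<open>y \<in> U\<close> by simp
      qed
      ultimately show "n' \<in> block_colourings (insert C S) M"
        unfolding block_colourings_def Un by simp metis
    qed
    show "g ` block_colourings (insert C S) M \<subseteq> (SIGMA i:R. block_colourings S (M - ?r i))"
    proof
      fix p assume "p \<in> g ` block_colourings (insert C S) M"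
      then obtain n where n: "n \<in> block_colourings (insert C S) M"
        and p: "p = (n c, restrict n U)"
        by (auto simp: g_def)
      have "n x = n c" if "x \<in> C" for x
        using n c that unfolding block_colourings_def by blast
      then have "image_mset n (mset_set C) = ?r (n c)"
        using C(1) by (intro image_mset_const)
      then have M: "M = ?r (n c) + image_mset n (mset_set U)"
        using n unfolding block_colourings_def Un mset_Un by auto
      have "image_mset (restrict n U) (mset_set U) = image_mset n (mset_set U)"
        using U by (intro image_mset_cong) auto
      then have "image_mset (restrict n U) (mset_set U) = M - ?r (n c)"
        by (simp add: M)
      moreover have "\<forall>D\<in>S. \<forall>x\<in>D. \<forall>y\<in>D. restrict n U x = restrict n U y"
      proof (intro ballI)
        fix D x y assume D: "D \<in> S" "x \<in> D" "y \<in> D"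
        have "n x = n y" using n D unfolding block_colourings_def by blast
        moreover have "x \<in> U" "y \<in> U" using D by (auto simp: U_def)
        ultimately show "restrict n U x = restrict n U y" by simp
      qed
      moreover have "restrict n U \<in> U \<rightarrow>\<^sub>E UNIV" by simp
      ultimately have "restrict n U \<in> block_colourings S (M - ?r (n c))"
        unfolding block_colourings_def U_def[symmetric] by blast
      moreover have "n c \<in> R"
        unfolding R_def using M by simp
      ultimately show "p \<in> (SIGMA i:R. block_colourings S (M - ?r i))"
        by (simp add: p)
    qed
  qed
  finally show ?case .
qed

section \<open>Tuples of a given weight and the cycles of a permutation\<close>

definition tuple_mset :: "nat \<Rightarrow> (nat \<Rightarrow> nat) \<Rightarrow> nat multiset" where
  "tuple_mset d n = image_mset n (mset_set {1..d})"

definition tuples_of :: "nat \<Rightarrow> nat multiset \<Rightarrow> (nat \<Rightarrow> nat) set" where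
  "tuples_of d M = {n \<in> tuples d. tuple_mset d n = M}"

lemma finite_tuples_of: "finite (tuples_of d M)"
  using finite_tuples_mset[of "{1..d}" M] by (simp add: tuples_of_def tuples_def tuple_mset_def)

abbreviation power_sum_monomial :: "nat \<Rightarrow> (nat \<Rightarrow> nat) \<Rightarrow> 'a::comm_ring_1 mseries" where
  "power_sum_monomial d \<sigma> \<equiv> \<Prod>s = 1..d. power_sum s ^ cycle_count d \<sigma> s"

text \<open>Provides the hypotheses under which block colourings can be applied to the cycles of a
  permutation.\<close>

lemma orbits_of_perm:
  fixes d :: nat
  assumes "\<sigma> permutes {1..d}"
  shows "finite (Orbits.orbit \<sigma> ` {1..d})" "\<Union>(Orbits.orbit \<sigma> ` {1..d}) = {1..d}"
    "disjoint (Orbits.orbit \<sigma> ` {1..d})"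
    "C \<in> Orbits.orbit \<sigma> ` {1..d} \<Longrightarrow> finite C \<and> C \<noteq> {} \<and> C \<subseteq> {1..d}"
proof -
  have perm: "permutation \<sigma>" using assms sym_group_carrier'[of \<sigma> d] by (simp add: sym_group_carrier)
  have sub: "Orbits.orbit \<sigma> x \<subseteq> {1..d}" if "x \<in> {1..d}" for x
    using permutes_orbit_subset[OF assms that] .
  have self: "x \<in> Orbits.orbit \<sigma> x" for x using permutation_self_in_orbit[OF perm] .
  show "finite (Orbits.orbit \<sigma> ` {1..d})" by simp
  show "\<Union>(Orbits.orbit \<sigma> ` {1..d}) = {1..d}" using sub self by blast
  show "disjoint (Orbits.orbit \<sigma> ` {1..d})"
    unfolding disjoint_def
    using orbit_cyclic_eq3[OF cyclic_on_orbit'[OF perm]] by blast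
  show "C \<in> Orbits.orbit \<sigma> ` {1..d} \<Longrightarrow> finite C \<and> C \<noteq> {} \<and> C \<subseteq> {1..d}"
    using sub self by (metis finite_atLeastAtMost finite_subset imageE empty_iff)
qed

text \<open>The action permutes positions by the inverse of \<sigma>, but a map is invariant under a
  permutation exactly if it is invariant under its inverse.\<close>

lemma perm_act_fixed_iff:
  assumes \<sigma>: "\<sigma> permutes {1..d}" and n: "n \<in> tuples d"
  shows "perm_act d \<sigma> n = n \<longleftrightarrow> (\<forall>x\<in>{1..d}. n (\<sigma> x) = n x)"
proof -
  have inv: "inv\<^bsub>sym_group d\<^esub> \<sigma> = inv' \<sigma>"
    using \<sigma> by (simp add: sym_group_carrier)
  have "perm_act d \<sigma> n = n \<longleftrightarrow> (\<forall>x\<in>{1..d}. n (inv' \<sigma> x) = n x)"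
    using n by (auto simp: perm_act_def inv tuples_def fun_eq_iff PiE_def extensional_def)
  also have "\<dots> \<longleftrightarrow> (\<forall>x\<in>{1..d}. n (\<sigma> x) = n x)"
    using permutes_in_image[OF \<sigma>] permutes_in_image[OF permutes_inv[OF \<sigma>]] permutes_inverses[OF \<sigma>]
    by metis
  finally show ?thesis .
qed

lemma const_on_orbits_iff:
  fixes d :: nat
  assumes \<sigma>: "\<sigma> permutes {1..d}"
  shows "(\<forall>C\<in>Orbits.orbit \<sigma> ` {1..d}. \<forall>x\<in>C. \<forall>y\<in>C. n x = n y)
    \<longleftrightarrow> (\<forall>x\<in>{1..d}. n (\<sigma> x) = n x)" (is "?L \<longleftrightarrow> ?R")
proof
  have perm: "permutation \<sigma>" using \<sigma> sym_group_carrier'[of \<sigma> d] by (simp add: sym_group_carrier)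
  show ?R if ?L
    using that permutation_self_in_orbit[OF perm] orbit.base[of \<sigma>] by blast
  assume R: ?R
  have *: "n y = n x" if "y \<in> Orbits.orbit \<sigma> x" "x \<in> {1..d}" for x y
    using that
  proof (induction)
    case base then show ?case using R by simp
  next
    case (step y)
    then have "y \<in> {1..d}" using permutes_orbit_subset[OF \<sigma>] by blast
    then show ?case using R step by simp
  qed
  then show ?L by fastforce
qed

text \<open>Grouping by cycle length turns the product over lengths into a product of
  \<open>power_sum (card C)\<close> over the cycles \<open>C\<close>. A colouring that is constant
  on cycles is the same thing as a tuple fixed by \<sigma>.\<close>

lemma coeff_power_sum_monomial:
  assumes \<sigma>: "\<sigma> permutes {1..d}"
  shows "coeff_of (power_sum_monomial d \<sigma> :: 'a::comm_ring_1 mseries) M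
    = of_nat (card {n \<in> tuples_of d M. perm_act d \<sigma> n = n})"
proof -
  let ?S = "Orbits.orbit \<sigma> ` {1..d}"
  note S = orbits_of_perm[OF \<sigma>]
  \<comment> \<open>Every cycle length lies between 1 and \<open>d\<close>, so the regrouping loses
    no cycle.\<close>
  have card: "card C \<in> {1..d}" if "C \<in> ?S" for C
    using S(4)[OF that] card_mono[of "{1..d}" C] by (auto simp: Suc_le_eq card_gt_0_iff)
  have "(power_sum_monomial d \<sigma> :: 'a mseries)
      = (\<Prod>s = 1..d. \<Prod>C\<in>{C \<in> ?S. card C = s}. power_sum (card C))"
    by (intro prod.cong refl) (simp add: cycle_count_def)
  also have "\<dots> = (\<Prod>C\<in>?S. power_sum (card C))"
    using card by (intro prod.group) (auto simp: S(1))
  finally have "coeff_of (power_sum_monomial d \<sigma> :: 'a mseries) M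
      = of_nat (card (block_colourings ?S M))"
    using coeff_prod_power_sum[of ?S M] S by simp
  also have "block_colourings ?S M = {n \<in> tuples_of d M. perm_act d \<sigma> n = n}"
    unfolding block_colourings_def S(2) const_on_orbits_iff[OF \<sigma>]
    by (auto simp: tuples_of_def tuples_def tuple_mset_def perm_act_fixed_iff[OF \<sigma>])
  finally show ?thesis .
qed

section \<open>Injectivity of the characteristic map\<close>

text \<open>Bijectivity needs no separate assumption: the map of the inverse element is a two-sided
  inverse.\<close>

lemma (in group) group_actionI:
  assumes ext: "\<And>g. g \<in> carrier G \<Longrightarrow> \<phi> g \<in> extensional E"
    and closed: "\<And>g x. g \<in> carrier G \<Longrightarrow> x \<in> E \<Longrightarrow> \<phi> g x \<in> E"
    and one: "\<And>x. x \<in> E \<Longrightarrow> \<phi> \<one> x = x"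
    and mult: "\<And>g h x. g \<in> carrier G \<Longrightarrow> h \<in> carrier G \<Longrightarrow> x \<in> E \<Longrightarrow> \<phi> (g \<otimes> h) x = \<phi> g (\<phi> h x)"
  shows "group_action G E \<phi>"
proof -
  have Bij: "\<phi> g \<in> Bij E" if g: "g \<in> carrier G" for g
  proof -
    have "bij_betw (\<phi> g) E E"
    proof (rule bij_betw_byWitness[of _ "\<phi> (inv g)"])
      show "\<forall>x\<in>E. \<phi> (inv g) (\<phi> g x) = x" "\<forall>x\<in>E. \<phi> g (\<phi> (inv g) x) = x"
        using g by (simp_all add: one flip: mult)
    qed (use g closed in auto)
    then show ?thesis using ext[OF g] by (simp add: Bij_def)
  qed
  have "\<phi> (g \<otimes> h) = compose E (\<phi> g) (\<phi> h)" if g: "g \<in> carrier G" and h: "h \<in> carrier G" for g h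
  proof (rule extensionalityI[of _ E])
    show "\<phi> (g \<otimes> h) \<in> extensional E" using g h by (intro ext) simp
    show "compose E (\<phi> g) (\<phi> h) \<in> extensional E" by simp
  qed (use mult[OF g h] in \<open>simp add: compose_eq\<close>)
  then have "\<phi> \<in> hom G (BijGroup E)"
    using Bij by (intro homI) (simp_all add: BijGroup_def)
  then show ?thesis
    unfolding group_action_def group_hom_def group_hom_axioms_def
    using is_group group_BijGroup by blast
qed

text \<open>Precomposition reverses products and so does inversion; together they give a left
  action.\<close>

lemma group_action_perm_act: "group_action (sym_group d) (tuples d) (perm_act d)"
proof -
  interpret G: group "sym_group d" by (rule sym_group_is_group)
  have inv: "inv\<^bsub>sym_group d\<^esub> \<sigma> = inv' \<sigma>" if "\<sigma> permutes {1..d}" for \<sigma>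
    using that by (simp add: sym_group_carrier)
  have closed: "perm_act d \<sigma> n \<in> tuples d" if "n \<in> tuples d" for \<sigma> n
    using that by (simp add: perm_act_def tuples_def)
  have act: "perm_act d \<sigma> n i = n (inv' \<sigma> i)"
    if "\<sigma> permutes {1..d}" "n \<in> tuples d" "i \<in> {1..d}" for \<sigma> n i
    using that by (simp only: perm_act_def inv restrict_apply')
  have tuple_eqI: "m = n" if "m \<in> tuples d" "n \<in> tuples d" "\<And>i. i \<in> {1..d} \<Longrightarrow> m i = n i" for m n
    using PiE_ext[of m "{1..d}" "\<lambda>_. UNIV" n] that by (simp only: tuples_def)
  have mult: "perm_act d (\<sigma> \<circ> \<tau>) n = perm_act d \<sigma> (perm_act d \<tau> n)"
    if \<sigma>: "\<sigma> permutes {1..d}" and \<tau>: "\<tau> permutes {1..d}" and n: "n \<in> tuples d" for \<sigma> \<tau> n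
  proof (rule tuple_eqI)
    fix i assume i: "i \<in> {1..d}"
    then have i': "inv' \<sigma> i \<in> {1..d}"
      by (simp only: permutes_in_image[OF permutes_inv[OF \<sigma>]])
    have "inv' (\<sigma> \<circ> \<tau>) = inv' \<tau> \<circ> inv' \<sigma>"
      by (rule o_inv_distrib[OF permutes_bij[OF \<sigma>] permutes_bij[OF \<tau>]])
    then show "perm_act d (\<sigma> \<circ> \<tau>) n i = perm_act d \<sigma> (perm_act d \<tau> n) i"
      by (simp only: act[OF permutes_compose[OF \<tau> \<sigma>] n i] act[OF \<sigma> closed[OF n] i]
          act[OF \<tau> n i'] comp_apply)
  qed (intro closed n)+
  have one: "perm_act d id n = n" if n: "n \<in> tuples d" for n
    by (rule tuple_eqI[OF closed[OF n] n]) (simp add: act[OF permutes_id n])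
  show ?thesis
    using mult closed one
    by (intro G.group_actionI) (simp_all add: sym_group_def perm_act_def)
qed

lemma tuple_mset_perm_act:
  assumes \<sigma>: "\<sigma> permutes {1..d}" and n: "n \<in> tuples d"
  shows "tuple_mset d (perm_act d \<sigma> n) = tuple_mset d n"
proof -
  have \<sigma>': "inv' \<sigma> permutes {1..d}" using \<sigma> by (rule permutes_inv)
  have "tuple_mset d (perm_act d \<sigma> n) = image_mset (\<lambda>i. n (inv' \<sigma> i)) (mset_set {1..d})"
    unfolding tuple_mset_def using n \<sigma>
    by (intro image_mset_cong) (simp add: perm_act_def sym_group_carrier)
  also have "\<dots> = image_mset n (image_mset (inv' \<sigma>) (mset_set {1..d}))"
    by (simp add: multiset.map_comp o_def)
  also have "\<dots> = tuple_mset d n"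
    using permutes_image_mset[OF \<sigma>'] by (simp add: tuple_mset_def)
  finally show ?thesis .
qed

lemma perm_act_tuples_of:
  assumes "\<sigma> \<in> carrier (sym_group d)" "n \<in> tuples_of d M"
  shows "perm_act d \<sigma> n \<in> tuples_of d M"
  using assms tuple_mset_perm_act[of \<sigma> d n]
    group_action.element_image[OF group_action_perm_act assms(1), of n]
  by (auto simp: tuples_of_def sym_group_carrier)

text \<open>The map \<open>\<phi> g\<close> carries the fixed points of \<open>s\<close> onto those
  of its conjugate. The invariant subset \<open>N\<close> allows the count to be restricted to
  tuples of one weight, which are finite in number.\<close>

lemma (in group_action) card_fixed_conj:
  assumes N: "N \<subseteq> E" and stable: "\<And>g x. g \<in> carrier G \<Longrightarrow> x \<in> N \<Longrightarrow> \<phi> g x \<in> N"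
    and g: "g \<in> carrier G" and s: "s \<in> carrier G"
  shows "card {x \<in> N. \<phi> (g \<otimes> s \<otimes> inv g) x = x} = card {x \<in> N. \<phi> s x = x}"
proof -
  interpret group G using group_hom group_hom.axioms(1) by blast
  have cancel: "\<phi> (inv g) (\<phi> g x) = x" "\<phi> g (\<phi> (inv g) x) = x" if "x \<in> N" for x
    using that N g orbit_sym_aux[OF g, of x] orbit_sym_aux[of "inv g" x] by auto
  have conj: "\<phi> (g \<otimes> s \<otimes> inv g) x = \<phi> g (\<phi> s (\<phi> (inv g) x))" if "x \<in> N" for x
  proof -
    have x: "x \<in> E" "\<phi> (inv g) x \<in> E" using that N stable g by auto
    show ?thesis
      using composition_rule[OF x(1), of "g \<otimes> s" "inv g"] composition_rule[OF x(2), of g s] g s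
      by simp
  qed
  have "bij_betw (\<phi> g) {x \<in> N. \<phi> s x = x} {x \<in> N. \<phi> (g \<otimes> s \<otimes> inv g) x = x}"
  proof (rule bij_betw_byWitness[of _ "\<phi> (inv g)"])
    show "\<phi> (inv g) ` {x \<in> N. \<phi> (g \<otimes> s \<otimes> inv g) x = x} \<subseteq> {x \<in> N. \<phi> s x = x}"
    proof clarify
      fix x assume x: "x \<in> N" "\<phi> (g \<otimes> s \<otimes> inv g) x = x"
      then have "\<phi> s (\<phi> (inv g) x) \<in> N" using stable g s by simp
      then have "\<phi> s (\<phi> (inv g) x) = \<phi> (inv g) x"
        using x conj[OF x(1)] cancel(1)[of "\<phi> s (\<phi> (inv g) x)"] by simp
      then show "\<phi> (inv g) x \<in> N \<and> \<phi> s (\<phi> (inv g) x) = \<phi> (inv g) x"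
        using x stable g by simp
    qed
  qed (use cancel stable conj g in auto)
  then show ?thesis by (simp add: bij_betw_same_card)
qed

text \<open>Cycle types need not be compared: each coefficient is a number of fixed points on an
  invariant set, and such numbers agree for conjugate elements.\<close>

lemma power_sum_monomial_conj:
  assumes "g \<in> carrier (sym_group d)" "s \<in> carrier (sym_group d)"
  shows "(power_sum_monomial d (g \<otimes>\<^bsub>sym_group d\<^esub> s \<otimes>\<^bsub>sym_group d\<^esub> inv\<^bsub>sym_group d\<^esub> g) :: 'a::comm_ring_1 mseries)
    = power_sum_monomial d s"
proof (rule mseries_eqI)
  fix M
  interpret group "sym_group d" by (rule sym_group_is_group)
  define t where "t = g \<otimes>\<^bsub>sym_group d\<^esub> s \<otimes>\<^bsub>sym_group d\<^esub> inv\<^bsub>sym_group d\<^esub> g"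
  have "t permutes {1..d}"
    using assms by (simp only: t_def flip: sym_group_carrier) (intro m_closed inv_closed)
  moreover have "s permutes {1..d}" using assms by (simp only: sym_group_carrier)
  moreover have "card {n \<in> tuples_of d M. perm_act d t n = n}
      = card {n \<in> tuples_of d M. perm_act d s n = n}"
    unfolding t_def
    by (rule group_action.card_fixed_conj[OF group_action_perm_act _ perm_act_tuples_of assms])
      (auto simp: tuples_of_def)
  ultimately show "coeff_of (power_sum_monomial d t :: 'a mseries) M
      = coeff_of (power_sum_monomial d s) M"
    by (simp only: coeff_power_sum_monomial)
qed

lemma coeff_ch:
  "coeff_of (ch d u) M = 1 / of_nat (fact d) * (\<Sum>\<sigma>\<in>carrier (sym_group d).
     u \<sigma> * of_nat (card {n \<in> tuples_of d M. perm_act d \<sigma> n = n}))"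
proof -
  have "coeff_of (ch d u) M = 1 / of_nat (fact d) * (\<Sum>\<sigma>\<in>carrier (sym_group d).
     u \<sigma> * coeff_of (power_sum_monomial d \<sigma>) M)"
    by (simp add: ch_def)
  also have "(\<Sum>\<sigma>\<in>carrier (sym_group d). u \<sigma> * coeff_of (power_sum_monomial d \<sigma>) M)
      = (\<Sum>\<sigma>\<in>carrier (sym_group d).
          u \<sigma> * of_nat (card {n \<in> tuples_of d M. perm_act d \<sigma> n = n}))"
    by (intro sum.cong refl) (simp only: coeff_power_sum_monomial sym_group_carrier)
  finally show ?thesis .
qed

section \<open>Generalized characters are class functions\<close>

lemma mat_trace_mult_comm:
  assumes A: "A \<in> carrier_mat n n" and B: "B \<in> carrier_mat n n"
  shows "mat_trace (A * B) = mat_trace (B * A :: 'a::comm_semiring_0 mat)"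
proof -
  have *: "mat_trace (A * B) = (\<Sum>i<n. \<Sum>j<n. A $$ (i, j) * B $$ (j, i))"
    if "A \<in> carrier_mat n n" "B \<in> carrier_mat n n" for A B :: "'a mat"
    using that by (simp add: mat_trace_def scalar_prod_def lessThan_atLeast0)
  note *[OF A B]
  also have "(\<Sum>i<n. \<Sum>j<n. A $$ (i, j) * B $$ (j, i)) = (\<Sum>j<n. \<Sum>i<n. B $$ (j, i) * A $$ (i, j))"
    by (subst sum.swap) (simp add: mult.commute)
  also have "\<dots> = mat_trace (B * A)"
    by (rule *[OF B A, symmetric])
  finally show ?thesis .
qed

definition class_function :: "nat \<Rightarrow> ((nat \<Rightarrow> nat) \<Rightarrow> 'k) \<Rightarrow> bool" where
  "class_function d u \<longleftrightarrow> (\<forall>g s. g permutes {1..d} \<longrightarrow> s permutes {1..d} \<longrightarrow> u (g \<circ> s \<circ> inv' g) = u s)"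

text \<open>The conjugating matrix is moved to the other side by the symmetry of the trace in a
  product, where it cancels against its inverse.\<close>

lemma characters_class_function:
  assumes "u \<in> characters d"
  shows "class_function d (u :: _ \<Rightarrow> 'k::field)"
  unfolding class_function_def
proof (intro allI impI)
  fix g s :: "nat \<Rightarrow> nat"
  assume g: "g permutes {1..d}" and s: "s permutes {1..d}"
  obtain \<rho> n where u: "u = (\<lambda>\<sigma>\<in>carrier (sym_group d). mat_trace (\<rho> \<sigma>))"
    and \<rho>: "\<rho> \<in> hom (sym_group d) (units_of (ring_mat TYPE('k) n ()))"
    using assms by (auto simp: characters_def)
  have carr: "\<rho> \<sigma> \<in> carrier_mat n n" if "\<sigma> permutes {1..d}" for \<sigma>
    using hom_in_carrier[OF \<rho>, of \<sigma>] that
    by (auto simp: units_of_def Units_def ring_mat_simps sym_group_carrier)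
  have mult: "\<rho> (\<sigma> \<circ> \<tau>) = \<rho> \<sigma> * \<rho> \<tau>" if "\<sigma> permutes {1..d}" "\<tau> permutes {1..d}" for \<sigma> \<tau>
    using hom_mult[OF \<rho>, of \<sigma> \<tau>] that
    by (simp add: units_of_mult ring_mat_simps sym_group_carrier sym_group_mult)
  have g': "inv' g permutes {1..d}" and gs: "g \<circ> s permutes {1..d}"
    using g s by (auto intro: permutes_inv permutes_compose)
  have "mat_trace (\<rho> (g \<circ> s \<circ> inv' g)) = mat_trace (\<rho> (inv' g \<circ> (g \<circ> s)))"
    unfolding mult[OF gs g'] mult[OF g' gs] by (rule mat_trace_mult_comm[OF carr[OF gs] carr[OF g']])
  also have "inv' g \<circ> (g \<circ> s) = s"
    by (simp add: fun_eq_iff permutes_inverses[OF g])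
  finally have *: "mat_trace (\<rho> (g \<circ> s \<circ> inv' g)) = mat_trace (\<rho> s)" .
  have "s \<in> carrier (sym_group d)" "g \<circ> s \<circ> inv' g \<in> carrier (sym_group d)"
    using gs g' s by (simp_all only: sym_group_carrier permutes_compose)
  then show "u (g \<circ> s \<circ> inv' g) = u s"
    unfolding u by (simp only: restrict_apply' *)
qed

lemma gen_characters_class_function:
  assumes "u \<in> gen_characters d"
  shows "class_function d u"
proof -
  obtain v w where u: "u = (\<lambda>\<sigma>\<in>carrier (sym_group d). v \<sigma> - w \<sigma>)"
    and "v \<in> characters d" "w \<in> characters d"
    using assms by (auto simp: gen_characters_def)
  then have vw: "class_function d v" "class_function d w"
    by (simp_all add: characters_class_function)
  show ?thesis
    unfolding class_function_def
  proof (intro allI impI)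
    fix g s :: "nat \<Rightarrow> nat"
    assume g: "g permutes {1..d}" and s: "s permutes {1..d}"
    then have "g \<circ> s \<circ> inv' g permutes {1..d}"
      by (intro permutes_compose permutes_inv)
    then show "u (g \<circ> s \<circ> inv' g) = u s"
      using vw g s by (simp add: u sym_group_carrier class_function_def)
  qed
qed

section \<open>Permutations with the same cycles\<close>

text \<open>On the orbit of \<open>c\<close> the map is a rotation, so coincidences among iterates
  depend on the orbit size alone. This makes it possible to compare iterates of two permutations
  whose orbits agree as sets.\<close>

lemma funpow_eq_iff_mod_card_orbit:
  assumes "c \<in> Orbits.orbit f c"
  shows "(f ^^ i) c = (f ^^ j) c
    \<longleftrightarrow> i mod card (Orbits.orbit f c) = j mod card (Orbits.orbit f c)"
proof -
  define p where "p = funpow_dist1 f c c"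
  have inj: "inj_on (\<lambda>n. (f ^^ n) c) {0..<p}"
    unfolding p_def by (rule inj_on_funpow_dist1[OF assms])
  have card: "card (Orbits.orbit f c) = p"
    using card_image[OF inj] orbit_conv_funpow_dist1[OF assms] by (simp add: p_def)
  have per: "(f ^^ p) c = c"
    unfolding p_def by (rule funpow_dist1_prop[OF assms])
  have mod: "(f ^^ i) c = (f ^^ (i mod p)) c" for i
    by (rule funpow_mod_eq[OF per, symmetric])
  have "p > 0" by (simp add: p_def)
  then have "(f ^^ (i mod p)) c = (f ^^ (j mod p)) c \<longleftrightarrow> i mod p = j mod p"
    using inj by (auto simp: inj_on_def)
  then show ?thesis using mod card by metis
qed

text \<open>Choose a base point in every common orbit and send its \<open>i\<close>-th iterate under
  \<sigma> to its \<open>i\<close>-th iterate under \<tau>. Equal orbit sizes make this consistent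
  and injective, and by construction it intertwines the two permutations.\<close>

lemma conj_if_same_orbits:
  fixes d :: nat
  assumes \<sigma>: "\<sigma> permutes {1..d}" and \<tau>: "\<tau> permutes {1..d}"
    and same: "\<And>x. x \<in> {1..d} \<Longrightarrow> Orbits.orbit \<sigma> x = Orbits.orbit \<tau> x"
  shows "\<exists>h. h permutes {1..d} \<and> \<tau> = h \<circ> \<sigma> \<circ> inv' h"
proof -
  have perm: "permutation \<sigma>" "permutation \<tau>"
    using \<sigma> \<tau> sym_group_carrier'[of _ d] by (simp_all add: sym_group_carrier)
  note self = permutation_self_in_orbit[OF perm(1)]
  have orbit_eq: "Orbits.orbit \<sigma> y = Orbits.orbit \<sigma> x" if "y \<in> Orbits.orbit \<sigma> x" for x y
    using orbit_cyclic_eq3[OF cyclic_on_orbit'[OF perm(1)] that] .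
  \<comment> \<open>The base point is chosen from the orbit as a set, hence it is the same for all
    points of one orbit; \<open>k x\<close> below is a number of steps from it to
    \<open>x\<close>.\<close>
  define r where "r x = (SOME y. y \<in> Orbits.orbit \<sigma> x)" for x
  have r: "r x \<in> Orbits.orbit \<sigma> x" for x
    unfolding r_def by (rule someI[of _ x]) (rule self)
  have r_eq: "r y = r x" if "y \<in> Orbits.orbit \<sigma> x" for x y
    using orbit_eq[OF that] by (simp add: r_def)
  have r_in: "r x \<in> {1..d}" if "x \<in> {1..d}" for x
    using permutes_orbit_subset[OF \<sigma> that] r by blast
  define k where "k x = funpow_dist \<sigma> (r x) x" for x
  have k: "(\<sigma> ^^ k x) (r x) = x" for x
    unfolding k_def using orbit_eq[OF r[of x]] self[of x] by (intro funpow_dist_prop) simp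
  have transfer: "(\<sigma> ^^ i) c = (\<sigma> ^^ j) c \<longleftrightarrow> (\<tau> ^^ i) c = (\<tau> ^^ j) c" if "c \<in> {1..d}" for i j c
    using funpow_eq_iff_mod_card_orbit[OF self[of c]]
      funpow_eq_iff_mod_card_orbit[OF permutation_self_in_orbit[OF perm(2), of c]] same[OF that]
    by simp
  define h where "h x = (if x \<in> {1..d} then (\<tau> ^^ k x) (r x) else x)" for x
  have h_orbit: "h x \<in> Orbits.orbit \<sigma> x" if "x \<in> {1..d}" for x
  proof -
    have "r x \<in> Orbits.orbit \<tau> x" using r[of x] same[OF that] by simp
    from funpow_in_orbit[OF this, of "k x"] show ?thesis using that same by (simp add: h_def)
  qed
  have h_in: "h x \<in> {1..d}" if "x \<in> {1..d}" for x
    using permutes_orbit_subset[OF \<sigma> that] h_orbit[OF that] by blast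
  have "inj_on h {1..d}"
  proof (rule inj_onI)
    fix x y assume xy: "x \<in> {1..d}" "y \<in> {1..d}" "h x = h y"
    have "r x = r y"
      using r_eq[OF h_orbit[OF xy(1)]] r_eq[OF h_orbit[OF xy(2)]] xy(3) by simp
    then have "(\<sigma> ^^ k x) (r x) = (\<sigma> ^^ k y) (r x)"
      using xy transfer[OF r_in[OF xy(1)], of "k x" "k y"] by (simp add: h_def)
    moreover have "(\<sigma> ^^ k y) (r x) = y" using k[of y] \<open>r x = r y\<close> by simp
    ultimately show "x = y" by (simp only: k)
  qed
  then have "bij_betw h {1..d} {1..d}"
    using endo_inj_surj[of "{1..d}" h] h_in unfolding bij_betw_def by blast
  then have h: "h permutes {1..d}"
    by (rule bij_imp_permutes) (auto simp: h_def)
  have "h (\<sigma> x) = \<tau> (h x)" for x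
  proof (cases "x \<in> {1..d}")
    case True
    have "\<sigma> x \<in> {1..d}" using True permutes_in_image[OF \<sigma>] by simp
    moreover have "r (\<sigma> x) = r x" by (rule r_eq) (rule orbit.base)
    moreover have "(\<sigma> ^^ k (\<sigma> x)) (r x) = (\<sigma> ^^ Suc (k x)) (r x)"
      using k[of "\<sigma> x"] k[of x] \<open>r (\<sigma> x) = r x\<close> by simp
    then have "(\<tau> ^^ k (\<sigma> x)) (r x) = (\<tau> ^^ Suc (k x)) (r x)"
      using transfer[OF r_in[OF True]] by blast
    ultimately show ?thesis using True by (simp add: h_def)
  next
    case False
    then show ?thesis
      using permutes_not_in[OF \<sigma> False] permutes_not_in[OF \<tau> False] by (auto simp: h_def)
  qed
  then have "h \<circ> \<sigma> = \<tau> \<circ> h" by auto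
  then have "h \<circ> \<sigma> \<circ> inv' h = \<tau>"
    using permutes_inv_o(1)[OF h] by (metis comp_assoc comp_id)
  then show ?thesis using h by metis
qed

lemma inj_on_ch: "inj_on (ch d :: _ \<Rightarrow> 'k::field_char_0 mseries) (gen_characters d)"
proof (rule inj_onI)
  fix u v :: "(nat \<Rightarrow> nat) \<Rightarrow> 'k"
  assume u: "u \<in> gen_characters d" and v: "v \<in> gen_characters d" and eq: "ch d u = ch d v"
  let ?G = "carrier (sym_group d)"
  let ?F = "\<lambda>M \<sigma>. {n \<in> tuples_of d M. perm_act d \<sigma> n = n}"
  let ?O = "\<lambda>\<sigma>. Orbits.orbit \<sigma> ` {1..d}"
  \<comment> \<open>Only two properties of the difference are used: it is constant on conjugacy
    classes, and by \<open>eq\<close> its pairing with every fixed point count vanishes.\<close>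
  define w where "w \<sigma> = u \<sigma> - v \<sigma>" for \<sigma>
  have conj: "w (g \<circ> s \<circ> inv' g) = w s" if "g permutes {1..d}" "s permutes {1..d}" for g s
    using gen_characters_class_function[OF u] gen_characters_class_function[OF v] that
    by (simp add: class_function_def w_def)
  have fin: "finite ?G"
    using finite_permutations[of "{1..d}"] by (simp add: sym_group_def)
  have zero: "(\<Sum>\<sigma>\<in>?G. w \<sigma> * of_nat (card (?F M \<sigma>))) = 0" for M
    using arg_cong[OF eq, of "\<lambda>f. coeff_of f M"]
    by (simp add: coeff_ch w_def left_diff_distrib sum_subtractf)
  have w_zero: "w \<sigma> = 0" if \<sigma>: "\<sigma> \<in> ?G" for \<sigma>
  proof (rule ccontr)
    assume "w \<sigma> \<noteq> 0"
    define S where "S = {\<sigma> \<in> ?G. w \<sigma> \<noteq> 0}"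
    have S: "finite S" "S \<noteq> {}" using fin \<sigma> \<open>w \<sigma> \<noteq> 0\<close> by (auto simp: S_def)
    define m where "m = Max ((\<lambda>\<tau>. card (?O \<tau>)) ` S)"
    have "m \<in> (\<lambda>\<tau>. card (?O \<tau>)) ` S"
      unfolding m_def using S by (intro Max_in) auto
    then obtain \<rho> where \<rho>: "\<rho> \<in> S" and m: "m = card (?O \<rho>)" by blast
    have max: "card (?O \<tau>) \<le> card (?O \<rho>)" if "\<tau> \<in> S" for \<tau>
      unfolding m[symmetric] m_def using S that by (intro Max_ge) auto
    have \<rho>_perm: "\<rho> permutes {1..d}" using \<rho> by (simp add: S_def sym_group_carrier)
    have perm: "permutation \<tau>" if "\<tau> permutes {1..d}" for \<tau>
      using that sym_group_carrier'[of \<tau> d] by (simp add: sym_group_carrier)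
    have self: "x \<in> Orbits.orbit \<tau> x" if "\<tau> permutes {1..d}" for x \<tau>
      using permutation_self_in_orbit[OF perm[OF that]] .
    have orbit_eq: "Orbits.orbit \<tau> y = Orbits.orbit \<tau> x"
      if "\<tau> permutes {1..d}" "y \<in> Orbits.orbit \<tau> x" for x y \<tau>
      using orbit_cyclic_eq3[OF cyclic_on_orbit'[OF perm[OF that(1)]] that(2)] .
    \<comment> \<open>\<open>c\<close> separates the cycles of \<open>\<rho>\<close>, so a permutation preserving it has finer cycles.\<close>
    define c where "c = (\<lambda>x\<in>{1..d}. Min (Orbits.orbit \<rho> x))"
    have Min_in: "Min (Orbits.orbit \<rho> x) \<in> Orbits.orbit \<rho> x" for x
      using finite_orbit[OF self[OF \<rho>_perm]] orbit_nonempty by (intro Min_in)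
    have c_in: "c x \<in> Orbits.orbit \<rho> x" if "x \<in> {1..d}" for x
      using that Min_in by (simp add: c_def)
    have c_tuple: "c \<in> tuples d" by (simp add: tuples_def c_def)
    define M where "M = tuple_mset d c"
    have "c (\<rho> x) = c x" if "x \<in> {1..d}" for x
      using that permutes_in_image[OF \<rho>_perm, of x] orbit_eq[OF \<rho>_perm orbit.base, of x]
      by (simp add: c_def)
    then have "c \<in> ?F M \<rho>"
      using c_tuple perm_act_fixed_iff[OF \<rho>_perm c_tuple] by (simp add: tuples_of_def M_def)
    \<comment> \<open>The reason is that such a \<tau> is conjugate to \<rho>: it has a conjugate
      preserving \<open>c\<close>, and maximality of the number of cycles of \<rho> forces that
      conjugate to have the same cycles as \<rho>.\<close>
    have same: "w \<tau> = w \<rho>" if \<tau>: "\<tau> \<in> S" and n: "n \<in> ?F M \<tau>" for \<tau> n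
    proof -
      have \<tau>_perm: "\<tau> permutes {1..d}" using \<tau> by (simp add: S_def sym_group_carrier)
      have n_tuple: "n \<in> tuples d" and n_mset: "tuple_mset d n = M"
        and "perm_act d \<tau> n = n"
        using n by (auto simp: tuples_of_def)
      then have n_inv: "n (\<tau> x) = n x" if "x \<in> {1..d}" for x
        using that perm_act_fixed_iff[OF \<tau>_perm n_tuple] by blast
      have "image_mset c (mset_set {1..d}) = image_mset n (mset_set {1..d})"
        using n_mset by (simp add: M_def tuple_mset_def)
      then obtain p where p: "p permutes {1..d}" and cp: "\<forall>x\<in>{1..d}. c x = n (p x)"
        by (rule image_mset_eq_implies_permutes[OF finite_atLeastAtMost])
      \<comment> \<open>The tuple \<open>n\<close> has the weight of \<open>c\<close>, so it is a
        rearrangement of \<open>c\<close> by \<open>p\<close>. Conjugating by \<open>p\<close>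
        replaces invariance of \<open>n\<close> by invariance of \<open>c\<close> itself.\<close>
      define \<tau>' where "\<tau>' = inv' p \<circ> \<tau> \<circ> p"
      have p': "inv' p permutes {1..d}" using p by (rule permutes_inv)
      have \<tau>': "\<tau>' permutes {1..d}"
        unfolding \<tau>'_def using p p' \<tau>_perm by (intro permutes_compose)
      have w_\<tau>': "w \<tau>' = w \<tau>"
        using conj[OF p' \<tau>_perm] permutes_inv_inv[OF p] by (simp add: \<tau>'_def)
      have c_inv: "c (\<tau>' x) = c x" if x: "x \<in> {1..d}" for x
      proof -
        have "\<tau>' x \<in> {1..d}" "p x \<in> {1..d}"
          using x permutes_in_image[OF \<tau>'] permutes_in_image[OF p] by auto
        then have "c (\<tau>' x) = n (\<tau> (p x))"
          using cp permutes_inverses(1)[OF p] by (simp add: \<tau>'_def)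
        also have "\<dots> = c x" using n_inv \<open>p x \<in> {1..d}\<close> cp x by simp
        finally show ?thesis .
      qed
      have finer: "Orbits.orbit \<tau>' x \<subseteq> Orbits.orbit \<rho> x" if x: "x \<in> {1..d}" for x
      proof
        fix y assume y: "y \<in> Orbits.orbit \<tau>' x"
        have "\<forall>C\<in>?O \<tau>'. \<forall>x\<in>C. \<forall>y\<in>C. c x = c y"
          using const_on_orbits_iff[OF \<tau>', of c] c_inv by blast
        then have "c y = c x" using x y self[OF \<tau>', of x] by blast
        moreover have "y \<in> {1..d}" using permutes_orbit_subset[OF \<tau>' x] y by blast
        ultimately have "Orbits.orbit \<rho> y = Orbits.orbit \<rho> x"
          using orbit_eq[OF \<rho>_perm c_in[OF x]] orbit_eq[OF \<rho>_perm c_in, of y] by simp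
        then show "y \<in> Orbits.orbit \<rho> x" using self[OF \<rho>_perm, of y] by simp
      qed
      \<comment> \<open>Sends a cycle of \<tau>' to the cycle of \<rho> containing it. It is
        surjective, and since \<rho> has the maximal number of cycles it is also injective; hence
        each cycle of \<rho> consists of a single cycle of \<tau>'.\<close>
      define \<Phi> where "\<Phi> C = Orbits.orbit \<rho> (Min C)" for C
      have \<Phi>: "\<Phi> (Orbits.orbit \<tau>' x) = Orbits.orbit \<rho> x" if x: "x \<in> {1..d}" for x
      proof -
        have "Min (Orbits.orbit \<tau>' x) \<in> Orbits.orbit \<tau>' x"
          using finite_orbit[OF self[OF \<tau>']] orbit_nonempty by (intro Lattices_Big.Min_in)
        then show ?thesis unfolding \<Phi>_def using finer[OF x] by (intro orbit_eq[OF \<rho>_perm]) blast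
      qed
      have image: "\<Phi> ` ?O \<tau>' = ?O \<rho>"
        unfolding image_image using \<Phi> by (intro image_cong) auto
      have "\<tau>' \<in> S" using \<tau> \<tau>' w_\<tau>' by (simp add: S_def sym_group_carrier)
      then have "card (?O \<tau>') = card (\<Phi> ` ?O \<tau>')"
        using max[of \<tau>'] card_image_le[of "?O \<tau>'" \<Phi>] image by simp
      then have inj: "inj_on \<Phi> (?O \<tau>')" by (intro eq_card_imp_inj_on) auto
      have "Orbits.orbit \<rho> x = Orbits.orbit \<tau>' x" if x: "x \<in> {1..d}" for x
      proof (rule antisym[OF _ finer[OF x]], rule subsetI)
        fix y assume y: "y \<in> Orbits.orbit \<rho> x"
        then have y_in: "y \<in> {1..d}" using permutes_orbit_subset[OF \<rho>_perm x] by blast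
        have "\<Phi> (Orbits.orbit \<tau>' y) = \<Phi> (Orbits.orbit \<tau>' x)"
          using \<Phi>[OF x] \<Phi>[OF y_in] orbit_eq[OF \<rho>_perm y] by simp
        then have "Orbits.orbit \<tau>' y = Orbits.orbit \<tau>' x"
          using inj x y_in by (auto dest: inj_onD)
        then show "y \<in> Orbits.orbit \<tau>' x" using self[OF \<tau>', of y] by simp
      qed
      then obtain h where "h permutes {1..d}" "\<tau>' = h \<circ> \<rho> \<circ> inv' h"
        using conj_if_same_orbits[OF \<rho>_perm \<tau>'] by blast
      then show ?thesis using conj \<rho>_perm w_\<tau>' by simp
    qed
    \<comment> \<open>All nonvanishing terms carry the common factor \<open>w \<rho>\<close>, and
      the remaining factor is a natural number. In characteristic zero it can vanish only if every
      summand does, but \<rho> fixes \<open>c\<close>.\<close>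
    have "(\<Sum>\<tau>\<in>?G. w \<tau> * of_nat (card (?F M \<tau>))) = (\<Sum>\<tau>\<in>S. w \<tau> * of_nat (card (?F M \<tau>)))"
      unfolding S_def using fin by (intro sum.mono_neutral_right) auto
    also have "\<dots> = (\<Sum>\<tau>\<in>S. w \<rho> * of_nat (card (?F M \<tau>)))"
    proof (rule sum.cong[OF refl])
      fix \<tau> assume \<tau>: "\<tau> \<in> S"
      show "w \<tau> * of_nat (card (?F M \<tau>)) = w \<rho> * of_nat (card (?F M \<tau>))"
      proof (cases "?F M \<tau> = {}")
        case True
        then show ?thesis by (simp only: card.empty of_nat_0 mult_zero_right)
      next
        case False
        then obtain n where "n \<in> ?F M \<tau>" by blast
        then have "w \<tau> = w \<rho>" by (rule same[OF \<tau>])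
        then show ?thesis by (simp only:)
      qed
    qed
    also have "\<dots> = w \<rho> * of_nat (\<Sum>\<tau>\<in>S. card (?F M \<tau>))"
      by (simp only: of_nat_sum sum_distrib_left)
    finally have "w \<rho> * of_nat (\<Sum>\<tau>\<in>S. card (?F M \<tau>)) = 0"
      by (simp only: zero)
    moreover have "w \<rho> \<noteq> 0" using \<rho> by (simp add: S_def)
    ultimately have "(\<Sum>\<tau>\<in>S. card (?F M \<tau>)) = 0"
      by (simp only: mult_eq_0_iff of_nat_eq_0_iff simp_thms)
    then have "card (?F M \<rho>) = 0"
      using S(1) \<rho> by (simp only: sum_eq_0_iff)
    moreover have "finite (?F M \<rho>)" using finite_tuples_of by simp
    ultimately have "?F M \<rho> = {}" by (simp only: card_0_eq)
    then show False using \<open>c \<in> ?F M \<rho>\<close> by blast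
  qed
  show "u = v"
  proof (rule ext)
    fix \<sigma>
    show "u \<sigma> = v \<sigma>"
    proof (cases "\<sigma> \<in> ?G")
      case True
      then show ?thesis using w_zero by (simp add: w_def)
    next
      case False
      \<comment> \<open>Outside the symmetric group both functions take the default value
        \<open>undefined\<close>.\<close>
      then show ?thesis using u v by (auto simp: gen_characters_def)
    qed
  qed
qed

section \<open>Orbit counting and the coefficients of a cycle index\<close>

lemma (in group_action) orbit_subset: "x \<in> E \<Longrightarrow> Group_Action.orbit G \<phi> x \<subseteq> E"
  using element_image by (auto simp: Group_Action.orbit_def)

lemma (in group_action) orbit_eq:
  assumes "x \<in> E" "y \<in> Group_Action.orbit G \<phi> x"
  shows "Group_Action.orbit G \<phi> y = Group_Action.orbit G \<phi> x"
proof -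
  have y: "y \<in> E" using orbit_subset assms by blast
  then have "x \<in> Group_Action.orbit G \<phi> y" using orbit_sym assms by blast
  then show ?thesis
    using orbit_trans[OF assms(1) y _ assms(2)] orbit_trans[OF y assms(1)] orbit_subset assms y
    by blast
qed

text \<open>\<open>E\<close> is the disjoint union of the orbits of the points of \<open>T\<close>,
  and \<open>f\<close> is constant on each of them.\<close>

lemma (in group_action) sum_eq_sum_representatives:
  fixes f :: "'c \<Rightarrow> 'r::comm_semiring_1"
  assumes "finite E" and "T \<subseteq> E"
    and reps: "\<forall>Q\<in>orbits G E \<phi>. \<exists>!x. x \<in> T \<and> x \<in> Q"
    and inv: "\<And>g x. g \<in> carrier G \<Longrightarrow> x \<in> E \<Longrightarrow> f (\<phi> g x) = f x"
  shows "(\<Sum>x\<in>E. f x) = (\<Sum>x\<in>T. of_nat (card (Group_Action.orbit G \<phi> x)) * f x)"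
proof -
  have T: "x \<in> E" if "x \<in> T" for x using that assms(2) by blast
  have orbits: "Group_Action.orbit G \<phi> x \<in> orbits G E \<phi>" if "x \<in> E" for x
    using that by (auto simp: orbits_def)
  have cover: "E = (\<Union>x\<in>T. Group_Action.orbit G \<phi> x)"
  proof
    show "E \<subseteq> (\<Union>x\<in>T. Group_Action.orbit G \<phi> x)"
    proof
      fix y assume y: "y \<in> E"
      then obtain x where "x \<in> T" "x \<in> Group_Action.orbit G \<phi> y" using reps orbits by blast
      then show "y \<in> (\<Union>x\<in>T. Group_Action.orbit G \<phi> x)" using orbit_sym[OF y] T by blast
    qed
  qed (use orbit_subset T in blast)
  have disj: "Group_Action.orbit G \<phi> x \<inter> Group_Action.orbit G \<phi> y = {}" if "x \<in> T" "y \<in> T" "x \<noteq> y" for x y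
  proof (rule ccontr)
    assume "Group_Action.orbit G \<phi> x \<inter> Group_Action.orbit G \<phi> y \<noteq> {}"
    then have "Group_Action.orbit G \<phi> x = Group_Action.orbit G \<phi> y"
      using orbit_eq[OF T[OF that(1)]] orbit_eq[OF T[OF that(2)]] by blast
    then show False
      using reps orbits[OF T[OF that(1)]] orbit_refl[OF T[OF that(1)]] orbit_refl[OF T[OF that(2)]] that
      by blast
  qed
  have fin: "finite (Group_Action.orbit G \<phi> x)" if "x \<in> T" for x
    using finite_subset[OF orbit_subset[OF T[OF that]]] assms(1) .
  have "(\<Sum>x\<in>E. f x) = (\<Sum>x\<in>T. \<Sum>y\<in>Group_Action.orbit G \<phi> x. f y)"
    by (subst cover, rule sum.UNION_disjoint)
      (use assms(1,2) fin disj finite_subset in auto)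
  also have "\<dots> = (\<Sum>x\<in>T. \<Sum>y\<in>Group_Action.orbit G \<phi> x. f x)"
    using inv T by (intro sum.cong refl) (auto simp: Group_Action.orbit_def)
  finally show ?thesis by simp
qed

text \<open>Burnside's count organized by points: by the orbit-stabilizer theorem the stabilizers
  along one orbit have orders summing to the order of \<open>G\<close>. It is stated for a finite
  invariant subset \<open>N\<close> because the set of all tuples may be infinite.\<close>

lemma (in group_action) card_orbits_eq_sum_stabilizers:
  assumes "finite (carrier G)" "finite N" "N \<subseteq> E"
    and stable: "\<And>g x. g \<in> carrier G \<Longrightarrow> x \<in> N \<Longrightarrow> \<phi> g x \<in> N"
  shows "card (Group_Action.orbit G \<phi> ` N) * Coset.order G = (\<Sum>x\<in>N. card (stabilizer G \<phi> x))"
proof -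
  have N: "x \<in> E" if "x \<in> N" for x using that assms(3) by blast
  have sub: "Group_Action.orbit G \<phi> x \<subseteq> N" if "x \<in> N" for x
    using that stable by (auto simp: Group_Action.orbit_def)
  have cover: "N = \<Union>(Group_Action.orbit G \<phi> ` N)" using sub orbit_refl N by blast
  have "(\<Sum>x\<in>N. card (stabilizer G \<phi> x))
      = (\<Sum>Q\<in>Group_Action.orbit G \<phi> ` N. \<Sum>x\<in>Q. card (stabilizer G \<phi> x))"
  proof (subst cover, subst sum.Union_disjoint)
    show "\<forall>Q\<in>Group_Action.orbit G \<phi> ` N. finite Q"
      using sub assms(2) finite_subset by blast
    show "\<forall>Q\<in>Group_Action.orbit G \<phi> ` N. \<forall>R\<in>Group_Action.orbit G \<phi> ` N. Q \<noteq> R \<longrightarrow> Q \<inter> R = {}"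
      using orbit_eq[OF N] by blast
  qed simp
  also have "\<dots> = (\<Sum>Q\<in>Group_Action.orbit G \<phi> ` N. Coset.order G)"
    using N assms(1) by (intro sum.cong refl card_stablizer_sum) (auto simp: orbits_def)
  finally show ?thesis by simp
qed

lemma (in group_action) stabilizer_conj:
  assumes "x \<in> E" "g \<in> carrier G" "s \<in> stabilizer G \<phi> (\<phi> g x)"
  shows "inv g \<otimes> s \<otimes> g \<in> stabilizer G \<phi> x"
proof -
  interpret group G using group_hom group_hom.axioms(1) by blast
  have s: "s \<in> carrier G" "\<phi> s (\<phi> g x) = \<phi> g x" using assms(3) by (auto simp: stabilizer_def)
  have gx: "\<phi> g x \<in> E" using element_image assms by blast
  have "\<phi> (inv g \<otimes> s \<otimes> g) x = \<phi> (inv g) (\<phi> s (\<phi> g x))"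
    using composition_rule[OF assms(1), of "inv g \<otimes> s" g] composition_rule[OF gx, of "inv g" s]
      assms(2) s(1) by simp
  also have "\<dots> = x" using s(2) orbit_sym_aux[OF assms(2,1)] by simp
  finally show ?thesis using assms(2) s(1) by (simp add: stabilizer_def)
qed

text \<open>Apply Burnside's count to \<open>K\<close> and to \<open>G\<close> on the
  \<open>G\<close>-orbit of \<open>x\<close>. Multiplied by the order of \<open>K\<close>, the
  number of \<open>K\<close>-orbits becomes the sum of the orders of
  \<open>stabilizer G \<phi> y \<inter> K\<close>, and the index becomes the sum of the orders of
  the full stabilizers. The sums agree exactly if they agree termwise.\<close>

lemma (in group_action) card_suborbits_eq_index_iff:
  assumes fin: "finite (carrier G)" and K: "K \<lhd> G" and x: "x \<in> E"
  shows "card {P \<in> orbits (G\<lparr>carrier := K\<rparr>) E \<phi>. P \<subseteq> Group_Action.orbit G \<phi> x} = card (rcosets K)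
    \<longleftrightarrow> stabilizer G \<phi> x \<subseteq> K"
proof -
  interpret group G using group_hom group_hom.axioms(1) by blast
  have sub: "subgroup K G" using K by (rule normal_imp_subgroup)
  interpret K: group_action "G\<lparr>carrier := K\<rparr>" E \<phi> by (rule induced_action[OF sub])
  have KG: "K \<subseteq> carrier G" using sub by (rule subgroup.subset)
  have fin_K: "finite K" using KG fin by (rule finite_subset)
  have "card K > 0" using fin_K subgroup.one_closed[OF sub] by (auto simp: card_gt_0_iff)
  let ?N = "Group_Action.orbit G \<phi> x"
  have fin_N: "finite ?N" using fin by (simp add: Group_Action.orbit_def)
  have N: "y \<in> E" "Group_Action.orbit G \<phi> y = ?N" if "y \<in> ?N" for y
    using that orbit_subset[OF x] orbit_eq[OF x] by auto
  have K_orbit: "Group_Action.orbit (G\<lparr>carrier := K\<rparr>) \<phi> y \<subseteq> Group_Action.orbit G \<phi> y" for y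
    using KG by (auto simp: Group_Action.orbit_def)
  have stab_K: "stabilizer (G\<lparr>carrier := K\<rparr>) \<phi> y = stabilizer G \<phi> y \<inter> K" for y
    using KG by (auto simp: stabilizer_def)
  have fin_stab: "finite (stabilizer G \<phi> y)" for y
    using finite_subset[OF stabilizer_subset fin] .
  have "{P \<in> orbits (G\<lparr>carrier := K\<rparr>) E \<phi>. P \<subseteq> ?N} = Group_Action.orbit (G\<lparr>carrier := K\<rparr>) \<phi> ` ?N"
  proof
    show "{P \<in> orbits (G\<lparr>carrier := K\<rparr>) E \<phi>. P \<subseteq> ?N} \<subseteq> Group_Action.orbit (G\<lparr>carrier := K\<rparr>) \<phi> ` ?N"
      using K.orbit_refl by (auto simp: orbits_def)
    show "Group_Action.orbit (G\<lparr>carrier := K\<rparr>) \<phi> ` ?N \<subseteq> {P \<in> orbits (G\<lparr>carrier := K\<rparr>) E \<phi>. P \<subseteq> ?N}"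
      using N K_orbit unfolding orbits_def by blast
  qed
  moreover have "card (Group_Action.orbit (G\<lparr>carrier := K\<rparr>) \<phi> ` ?N) * Coset.order (G\<lparr>carrier := K\<rparr>)
      = (\<Sum>y\<in>?N. card (stabilizer G \<phi> y \<inter> K))"
    unfolding stab_K[symmetric]
  proof (rule K.card_orbits_eq_sum_stabilizers)
    fix g y assume "g \<in> carrier (G\<lparr>carrier := K\<rparr>)" "y \<in> ?N"
    then show "\<phi> g y \<in> ?N" using N(2)[of y] KG by (auto simp: Group_Action.orbit_def)
  qed (use fin_K fin_N orbit_subset[OF x] in simp_all)
  moreover have "card (rcosets K) * card K = (\<Sum>y\<in>?N. card (stabilizer G \<phi> y))"
  proof -
    \<comment> \<open>By Lagrange the left-hand side is the order of \<open>G\<close>, which is also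
      the sum of the stabilizer orders over a single orbit.\<close>
    have "?N \<in> orbits G E \<phi>" using x unfolding orbits_def by blast
    from card_stablizer_sum[OF fin this] lagrange[OF sub] show ?thesis by simp
  qed
  moreover have "(\<Sum>y\<in>?N. card (stabilizer G \<phi> y \<inter> K)) = (\<Sum>y\<in>?N. card (stabilizer G \<phi> y))
      \<longleftrightarrow> stabilizer G \<phi> x \<subseteq> K"
  proof
    assume "(\<Sum>y\<in>?N. card (stabilizer G \<phi> y \<inter> K)) = (\<Sum>y\<in>?N. card (stabilizer G \<phi> y))"
    then have "card (stabilizer G \<phi> x \<inter> K) = card (stabilizer G \<phi> x)"
      by (rule sum_mono_inv) (use fin_N fin_stab orbit_refl[OF x] in \<open>auto intro: card_mono\<close>)
    then have "stabilizer G \<phi> x \<inter> K = stabilizer G \<phi> x"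
      using fin_stab by (intro card_subset_eq) auto
    then show "stabilizer G \<phi> x \<subseteq> K" by blast
  next
    assume stab: "stabilizer G \<phi> x \<subseteq> K"
    \<comment> \<open>The stabilizer of another point of the orbit is a conjugate of that of
      \<open>x\<close>, and the normal subgroup \<open>K\<close> contains all conjugates of its
      elements.\<close>
    have "stabilizer G \<phi> y \<subseteq> K" if "y \<in> ?N" for y
    proof
      fix s assume s: "s \<in> stabilizer G \<phi> y"
      obtain g where g: "g \<in> carrier G" "y = \<phi> g x" using \<open>y \<in> ?N\<close> by (auto simp: Group_Action.orbit_def)
      then have k: "inv g \<otimes> s \<otimes> g \<in> K" using stabilizer_conj[OF x] s stab by blast
      have "g \<otimes> (inv g \<otimes> s \<otimes> g) \<otimes> inv g \<in> K"
        using normal.inv_op_closed2[OF K g(1) k] .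
      then show "s \<in> K"
        using conjugation_is_surj[OF g(1), of s] s by (simp add: stabilizer_def)
    qed
    then show "(\<Sum>y\<in>?N. card (stabilizer G \<phi> y \<inter> K)) = (\<Sum>y\<in>?N. card (stabilizer G \<phi> y))"
      by (intro sum.cong refl arg_cong[of _ _ card]) blast
  qed
  moreover have "Coset.order (G\<lparr>carrier := K\<rparr>) = card K" by (simp add: Coset.order_def)
  ultimately have "card {P \<in> orbits (G\<lparr>carrier := K\<rparr>) E \<phi>. P \<subseteq> ?N} * card K = card (rcosets K) * card K
      \<longleftrightarrow> stabilizer G \<phi> x \<subseteq> K"
    by (simp only:)
  then show ?thesis using \<open>card K > 0\<close> by simp
qed

section \<open>One-dimensional characters\<close>

lemma mult_group_simps:
  "carrier (mult_group :: 'k::field monoid) = {x. x \<noteq> 0}"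
  "x \<otimes>\<^bsub>mult_group\<^esub> y = (x * y :: 'k)"
  "\<one>\<^bsub>mult_group\<^esub> = (1 :: 'k)"
proof -
  have "Units (ring_of_type_algebra :: 'k ring) = {x. x \<noteq> 0}"
    unfolding Units_def ring_of_type_algebra_def
    by auto (metis left_inverse right_inverse)
  then show "carrier (mult_group :: 'k monoid) = {x. x \<noteq> 0}"
    by (simp add: mult_group_def units_of_carrier)
qed (simp_all add: mult_group_def units_of_mult units_of_one ring_of_type_algebra_def)

lemma group_mult_group: "group (mult_group :: 'k::field monoid)"
proof -
  interpret field "ring_of_type_algebra :: 'k ring" by (rule field_from_type_algebra)
  show ?thesis unfolding mult_group_def by (rule units_group)
qed

lemma hom_mult_group_iff:
  "\<chi> \<in> hom G (mult_group :: 'k::field monoid) \<longleftrightarrow>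
    (\<forall>x\<in>carrier G. \<chi> x \<noteq> 0) \<and> (\<forall>x\<in>carrier G. \<forall>y\<in>carrier G. \<chi> (x \<otimes>\<^bsub>G\<^esub> y) = \<chi> x * \<chi> y)"
  by (auto simp: hom_def mult_group_simps)

text \<open>If \<open>\<chi> g \<noteq> 1\<close>, translation by \<open>g\<close> multiplies the
  sum by \<open>\<chi> g\<close> without changing it, so the sum vanishes.\<close>

lemma (in group) sum_one_dim_char:
  assumes \<chi>: "\<chi> \<in> hom G (mult_group :: 'k::field monoid)"
  shows "(\<Sum>x\<in>carrier G. \<chi> x) = (if \<forall>x\<in>carrier G. \<chi> x = 1 then of_nat (Coset.order G) else 0)"
proof (cases "\<forall>x\<in>carrier G. \<chi> x = 1")
  case True
  then show ?thesis by (simp add: Coset.order_def)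
next
  case False
  then obtain g where g: "g \<in> carrier G" "\<chi> g \<noteq> 1" by blast
  have "(\<Sum>x\<in>carrier G. \<chi> x) = (\<Sum>x\<in>carrier G. \<chi> (g \<otimes> x))"
    using g by (intro sum.reindex_bij_witness[of _ "\<lambda>x. g \<otimes> x" "\<lambda>x. inv g \<otimes> x"])
      (auto simp flip: m_assoc)
  also have "\<dots> = \<chi> g * (\<Sum>x\<in>carrier G. \<chi> x)"
    using \<chi> g by (simp add: hom_mult_group_iff sum_distrib_left)
  finally have "(\<chi> g - 1) * (\<Sum>x\<in>carrier G. \<chi> x) = 0" by (simp add: algebra_simps)
  then show ?thesis using False g by auto
qed

lemma finite_sym_group: "finite (carrier (sym_group d))"
  using finite_permutations[of "{1..d}"] by (simp add: sym_group_def)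

section \<open>Orbit weights and the orbits in \<open>J\<close>\<close>

lemma tuple_mset_orbit:
  assumes H: "subgroup H (sym_group d)" and Q: "Q \<in> tuple_orbits d H" and n: "n \<in> Q"
  shows "Q \<subseteq> tuples_of d (tuple_mset d n)"
proof -
  interpret S: group_action "sym_group d" "tuples d" "perm_act d" by (rule group_action_perm_act)
  interpret group_action "sym_group d\<lparr>carrier := H\<rparr>" "tuples d" "perm_act d"
    by (rule S.induced_action[OF H])
  obtain m where m: "m \<in> tuples d" "Q = Group_Action.orbit (sym_group d\<lparr>carrier := H\<rparr>) (perm_act d) m"
    using Q by (auto simp: tuple_orbits_def orbits_def)
  have "Q = Group_Action.orbit (sym_group d\<lparr>carrier := H\<rparr>) (perm_act d) n" "n \<in> tuples d"
    using orbit_eq[OF m(1)] orbit_subset[OF m(1)] n m(2) by auto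
  moreover have "\<sigma> \<in> carrier (sym_group d)" if "\<sigma> \<in> H" for \<sigma>
    using that subgroup.subset[OF H] by blast
  ultimately show ?thesis
    using perm_act_tuples_of[of _ d n "tuple_mset d n"] by (auto simp: Group_Action.orbit_def tuples_of_def)
qed

text \<open>All tuples of an orbit have one weight, so \<open>the_elem\<close> is applied to a
  singleton and yields a monomial. That this monomial is \<open>M\<close> is expressed by
  \<open>Q \<subseteq> tuples_of d M\<close>.\<close>

lemma coeff_orbit_weight:
  assumes H: "subgroup H (sym_group d)" and Q: "Q \<in> tuple_orbits d H"
  shows "coeff_of (orbit_weight d Q :: 'k::field mseries) M = (if Q \<subseteq> tuples_of d M then 1 else 0)"
proof -
  interpret S: group_action "sym_group d" "tuples d" "perm_act d" by (rule group_action_perm_act)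
  interpret group_action "sym_group d\<lparr>carrier := H\<rparr>" "tuples d" "perm_act d"
    by (rule S.induced_action[OF H])
  obtain n where n: "n \<in> Q"
    using Q orbit_refl by (auto simp: tuple_orbits_def orbits_def)
  note Q_sub = tuple_mset_orbit[OF H Q n]
  have "(\<lambda>n. \<Prod>i = 1..d. var (n i) :: 'k mseries) ` Q = {monomial (tuple_mset d n)}"
    using Q_sub n by (auto simp: prod_var tuple_mset_def tuples_of_def)
  then have "orbit_weight d Q = (monomial (tuple_mset d n) :: 'k mseries)"
    by (simp add: orbit_weight_def)
  moreover have "Q \<subseteq> tuples_of d M \<longleftrightarrow> M = tuple_mset d n"
    using Q_sub n by (auto simp: tuples_of_def)
  ultimately show ?thesis by (simp add: coeff_monomial)
qed

lemma J_orbits_subset: "J_orbits d H \<psi> \<subseteq> tuple_orbits d H"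
  by (auto simp: J_orbits_def Let_def)

text \<open>The criterion for suborbits is applied to the kernel of \<psi>: the number of suborbits
  is maximal exactly if the stabilizer lies in the kernel.\<close>

lemma J_orbits_eq:
  fixes \<psi> :: "_ \<Rightarrow> 'k::field"
  assumes H: "subgroup H (sym_group d)" and \<psi>: "one_dim_char d H \<psi>"
  shows "J_orbits d H \<psi> = Group_Action.orbit (sym_group d\<lparr>carrier := H\<rparr>) (perm_act d) `
    {n \<in> tuples d. \<forall>\<sigma>\<in>H. perm_act d \<sigma> n = n \<longrightarrow> \<psi> \<sigma> = 1}"
proof -
  interpret S: group_action "sym_group d" "tuples d" "perm_act d" by (rule group_action_perm_act)
  let ?H = "sym_group d\<lparr>carrier := H\<rparr>" and ?K = "kernel (sym_group d\<lparr>carrier := H\<rparr>) mult_group \<psi>"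
  interpret group_action ?H "tuples d" "perm_act d"
    by (rule S.induced_action[OF H])
  interpret \<psi>: group_hom ?H "mult_group :: 'k monoid" \<psi>
    using \<psi> group_hom group_mult_group
    by (simp add: one_dim_char_def group_hom_def group_hom_axioms_def)
  have fin: "finite (carrier ?H)"
    using finite_subset[OF subgroup.subset[OF H] finite_sym_group] by simp
  have K_orbits: "tuple_orbits d ?K = orbits (?H\<lparr>carrier := ?K\<rparr>) (tuples d) (perm_act d)"
    by (simp add: tuple_orbits_def)
  have "card {P \<in> tuple_orbits d ?K. P \<subseteq> Group_Action.orbit ?H (perm_act d) n} = card (rcosets\<^bsub>?H\<^esub> ?K)
      \<longleftrightarrow> (\<forall>\<sigma>\<in>H. perm_act d \<sigma> n = n \<longrightarrow> \<psi> \<sigma> = 1)" if "n \<in> tuples d" for n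
    unfolding K_orbits card_suborbits_eq_index_iff[OF fin \<psi>.normal_kernel that]
    by (auto simp: stabilizer_def kernel_def mult_group_simps)
  then show ?thesis
    unfolding J_orbits_def Let_def tuple_orbits_def[of d H] orbits_def
    by (auto simp: image_def)
qed

text \<open>Sum \<open>\<psi> \<sigma>\<close> over all pairs of \<sigma> in \<open>H\<close> and a
  tuple of weight \<open>M\<close> fixed by \<sigma>. For a fixed tuple this is a character sum over
  its stabilizer, giving the order of the stabilizer if \<psi> is trivial there and 0 otherwise.
  Burnside's count on the surviving tuples yields the order of \<open>H\<close> for every orbit in
  \<open>J\<close>.\<close>

lemma card_J_orbits:
  fixes \<psi> :: "_ \<Rightarrow> 'k::field"
  assumes H: "subgroup H (sym_group d)" and \<psi>: "one_dim_char d H \<psi>"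
  shows "of_nat (card H) * of_nat (card {Q \<in> J_orbits d H \<psi>. Q \<subseteq> tuples_of d M})
    = (\<Sum>\<sigma>\<in>H. \<psi> \<sigma> * of_nat (card {n \<in> tuples_of d M. perm_act d \<sigma> n = n}))"
proof -
  interpret S: group_action "sym_group d" "tuples d" "perm_act d" by (rule group_action_perm_act)
  let ?H = "sym_group d\<lparr>carrier := H\<rparr>"
  interpret group_action ?H "tuples d" "perm_act d"
    by (rule S.induced_action[OF H])
  interpret H: group ?H using group_hom group_hom.axioms(1) by blast
  let ?triv = "\<lambda>n. \<forall>\<sigma>\<in>H. perm_act d \<sigma> n = n \<longrightarrow> \<psi> \<sigma> = 1"
  let ?stab = "\<lambda>n. stabilizer ?H (perm_act d) n"
  have stab: "?stab n = {\<sigma> \<in> H. perm_act d \<sigma> n = n}" for n by (simp add: stabilizer_def)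
  have fin_H: "finite H" using finite_subset[OF subgroup.subset[OF H] finite_sym_group] .
  have tuple: "n \<in> tuples d" if "n \<in> tuples_of d M" for n using that by (simp add: tuples_of_def)
  have H_sub: "\<sigma> \<in> carrier (sym_group d)" if "\<sigma> \<in> H" for \<sigma>
    using that subgroup.subset[OF H] by blast
  have sum_stab: "(\<Sum>\<sigma>\<in>?stab n. \<psi> \<sigma>) = (if ?triv n then of_nat (card (?stab n)) else 0)"
    if "n \<in> tuples d" for n
  proof -
    interpret stab: group "?H\<lparr>carrier := ?stab n\<rparr>"
      by (rule H.subgroup_imp_group[OF stabilizer_subgroup[OF that]])
    have "\<psi> \<in> hom (?H\<lparr>carrier := ?stab n\<rparr>) mult_group"
      using \<psi> stabilizer_subset[of n] unfolding one_dim_char_def hom_mult_group_iff by auto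
    from stab.sum_one_dim_char[OF this] show ?thesis
      by (auto simp: Coset.order_def stab split: if_splits)
  qed
  have "(\<Sum>\<sigma>\<in>H. \<psi> \<sigma> * of_nat (card {n \<in> tuples_of d M. perm_act d \<sigma> n = n}))
      = (\<Sum>\<sigma>\<in>H. \<Sum>n\<in>tuples_of d M. if perm_act d \<sigma> n = n then \<psi> \<sigma> else 0)"
    using finite_tuples_of[of d M]
    by (intro sum.cong refl) (simp add: mult.commute flip: sum.inter_filter)
  also have "\<dots> = (\<Sum>n\<in>tuples_of d M. \<Sum>\<sigma>\<in>?stab n. \<psi> \<sigma>)"
    unfolding stab using fin_H by (subst sum.swap) (simp flip: sum.inter_filter)
  also have "\<dots> = (\<Sum>n\<in>tuples_of d M. if ?triv n then of_nat (card (?stab n)) else 0)"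
    using tuple sum_stab by (intro sum.cong refl) blast
  also have "\<dots> = of_nat (\<Sum>n\<in>{n \<in> tuples_of d M. ?triv n}. card (?stab n))"
    using finite_tuples_of[of d M] by (simp flip: sum.inter_filter)
  also have "(\<Sum>n\<in>{n \<in> tuples_of d M. ?triv n}. card (?stab n))
      = card (Group_Action.orbit ?H (perm_act d) ` {n \<in> tuples_of d M. ?triv n}) * Coset.order ?H"
  proof (rule card_orbits_eq_sum_stabilizers[symmetric])
    fix g n assume g: "g \<in> carrier ?H" and n: "n \<in> {n \<in> tuples_of d M. ?triv n}"
    have "\<psi> \<sigma> = 1" if \<sigma>: "\<sigma> \<in> H" "perm_act d \<sigma> (perm_act d g n) = perm_act d g n" for \<sigma>
    proof -
      \<comment> \<open>Triviality of \<psi> on the stabilizer is preserved along an orbit: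
        conjugation by \<open>g\<close> moves \<sigma> into the stabilizer of \<open>n\<close>, and
        \<psi> takes the same value on conjugate elements.\<close>
      define \<tau> where "\<tau> = inv\<^bsub>?H\<^esub> g \<otimes>\<^bsub>?H\<^esub> \<sigma> \<otimes>\<^bsub>?H\<^esub> g"
      have \<sigma>_in: "\<sigma> \<in> carrier ?H" using \<sigma>(1) by simp
      then have \<tau>_in: "\<tau> \<in> carrier ?H" using g unfolding \<tau>_def by (intro H.m_closed H.inv_closed)
      have "\<tau> \<in> ?stab n"
        unfolding \<tau>_def using \<sigma> n tuple g by (intro stabilizer_conj) (auto simp: stabilizer_def)
      then have "\<psi> \<tau> = 1" using n unfolding stab by blast
      have "g \<otimes>\<^bsub>?H\<^esub> \<tau> = g \<otimes>\<^bsub>?H\<^esub> (inv\<^bsub>?H\<^esub> g \<otimes>\<^bsub>?H\<^esub> (\<sigma> \<otimes>\<^bsub>?H\<^esub> g))"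
        unfolding \<tau>_def by (subst H.m_assoc[OF H.inv_closed[OF g] \<sigma>_in g]) (rule refl)
      also have "\<dots> = \<sigma> \<otimes>\<^bsub>?H\<^esub> g"
        by (subst H.m_assoc[symmetric, OF g H.inv_closed[OF g] H.m_closed[OF \<sigma>_in g]])
          (simp only: H.r_inv[OF g] H.l_one[OF H.m_closed[OF \<sigma>_in g]])
      finally have "\<psi> g * \<psi> \<tau> = \<psi> \<sigma> * \<psi> g"
        using \<psi> g \<sigma>_in \<tau>_in unfolding one_dim_char_def hom_mult_group_iff by metis
      moreover have "\<psi> g \<noteq> 0" using \<psi> g unfolding one_dim_char_def hom_mult_group_iff by blast
      ultimately show ?thesis using \<open>\<psi> \<tau> = 1\<close> by simp
    qed
    then show "perm_act d g n \<in> {n \<in> tuples_of d M. ?triv n}"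
      using perm_act_tuples_of[OF H_sub] g n by simp
  qed (use fin_H finite_tuples_of tuple in auto)
  also have "Group_Action.orbit ?H (perm_act d) ` {n \<in> tuples_of d M. ?triv n}
      = {Q \<in> J_orbits d H \<psi>. Q \<subseteq> tuples_of d M}"
  proof
    show "Group_Action.orbit ?H (perm_act d) ` {n \<in> tuples_of d M. ?triv n}
        \<subseteq> {Q \<in> J_orbits d H \<psi>. Q \<subseteq> tuples_of d M}"
      unfolding J_orbits_eq[OF H \<psi>]
      using perm_act_tuples_of[OF H_sub] tuple by (auto simp: Group_Action.orbit_def)
    show "{Q \<in> J_orbits d H \<psi>. Q \<subseteq> tuples_of d M}
        \<subseteq> Group_Action.orbit ?H (perm_act d) ` {n \<in> tuples_of d M. ?triv n}"
      unfolding J_orbits_eq[OF H \<psi>] using orbit_refl by blast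
  qed
  finally show ?thesis by (simp add: Coset.order_def mult.commute)
qed

lemma coeff_cycle_index:
  fixes \<psi> :: "_ \<Rightarrow> 'k::field_char_0"
  assumes H: "subgroup H (sym_group d)" and \<psi>: "one_dim_char d H \<psi>"
  shows "coeff_of (cycle_index d H \<psi> power_sum) M
    = of_nat (card {Q \<in> J_orbits d H \<psi>. Q \<subseteq> tuples_of d M})"
proof -
  have "finite H" using finite_subset[OF subgroup.subset[OF H] finite_sym_group] .
  then have "card H \<noteq> 0" using subgroup.one_closed[OF H] by auto
  have "coeff_of (cycle_index d H \<psi> power_sum) M
      = 1 / of_nat (card H) * (\<Sum>\<sigma>\<in>H. \<psi> \<sigma> * coeff_of (power_sum_monomial d \<sigma>) M)"
    by (simp add: cycle_index_def)
  also have "(\<Sum>\<sigma>\<in>H. \<psi> \<sigma> * coeff_of (power_sum_monomial d \<sigma>) M)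
      = (\<Sum>\<sigma>\<in>H. \<psi> \<sigma> * of_nat (card {n \<in> tuples_of d M. perm_act d \<sigma> n = n}))"
    using subgroup.subset[OF H]
    by (intro sum.cong refl arg_cong2[of _ _ _ _ "(*)"] coeff_power_sum_monomial)
      (auto simp only: sym_group_carrier)
  also have "1 / of_nat (card H) * \<dots> = of_nat (card {Q \<in> J_orbits d H \<psi>. Q \<subseteq> tuples_of d M})"
    unfolding card_J_orbits[OF H \<psi>, symmetric] using \<open>card H \<noteq> 0\<close> by simp
  finally show ?thesis .
qed

section \<open>Monomial representations\<close>

lemma order_sym_group: "Coset.order (sym_group d) = fact d"
  using card_permutations[of "{1..d}" d] by (simp add: Coset.order_def sym_group_def)

text \<open>Encodes a representation with a basis indexed by \<open>E\<close> in which
  \<open>g\<close> maps the basis vector of \<open>x\<close> to \<open>c x g\<close> times that of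
  \<open>a g x\<close>. The cocycle equation says that products act as compositions.\<close>

locale monomial_rep =
  fixes d :: nat and E :: "'x set" and a :: "(nat \<Rightarrow> nat) \<Rightarrow> 'x \<Rightarrow> 'x"
    and c :: "'x \<Rightarrow> (nat \<Rightarrow> nat) \<Rightarrow> 'k::field_char_0"
  assumes action: "group_action (sym_group d) E a"
    and finite_points: "finite E"
    and nonzero: "x \<in> E \<Longrightarrow> g \<in> carrier (sym_group d) \<Longrightarrow> c x g \<noteq> 0"
    and cocycle: "x \<in> E \<Longrightarrow> g \<in> carrier (sym_group d) \<Longrightarrow> h \<in> carrier (sym_group d) \<Longrightarrow>
      c x (g \<otimes>\<^bsub>sym_group d\<^esub> h) = c (a h x) g * c x h"
begin

sublocale group_action "sym_group d" E a by (rule action)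
sublocale group "sym_group d" by (rule sym_group_is_group)

text \<open>The trace of this representation: only fixed points have a nonzero diagonal
  entry.\<close>

definition monomial_char :: "(nat \<Rightarrow> nat) \<Rightarrow> 'k" where
  "monomial_char = (\<lambda>\<sigma>\<in>carrier (sym_group d). \<Sum>x\<in>E. if a \<sigma> x = x then c x \<sigma> else 0)"

lemma action_one: "x \<in> E \<Longrightarrow> a \<one>\<^bsub>sym_group d\<^esub> x = x"
  by (metis id_eq_one restrict_apply')

lemma cocycle_one:
  assumes "x \<in> E"
  shows "c x \<one>\<^bsub>sym_group d\<^esub> = 1"
  using cocycle[OF assms one_closed one_closed] nonzero[OF assms one_closed] action_one[OF assms]
  by simp

text \<open>On the stabilizer the shifted point \<open>a h x\<close> in the cocycle equation is
  \<open>x\<close> again, so the equation becomes multiplicativity.\<close>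

lemma one_dim_char_stabilizer:
  assumes "x \<in> E"
  shows "one_dim_char d (stabilizer (sym_group d) a x) (c x)"
  unfolding one_dim_char_def hom_mult_group_iff
  using nonzero[OF assms] cocycle[OF assms] by (simp add: stabilizer_def)

text \<open>Evaluate the cocycle on the conjugate times \<open>g\<close>, which equals
  \<open>g\<close> times \<open>s\<close>, in both ways; the nonzero factor \<open>c x g\<close>
  cancels.\<close>

lemma cocycle_conj:
  assumes x: "x \<in> E" and g: "g \<in> carrier (sym_group d)" and s: "s \<in> stabilizer (sym_group d) a x"
  shows "c (a g x) (g \<otimes>\<^bsub>sym_group d\<^esub> s \<otimes>\<^bsub>sym_group d\<^esub> inv\<^bsub>sym_group d\<^esub> g) = c x s"
proof -
  have s': "s \<in> carrier (sym_group d)" "a s x = x" using s by (auto simp: stabilizer_def)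
  let ?t = "g \<otimes>\<^bsub>sym_group d\<^esub> s \<otimes>\<^bsub>sym_group d\<^esub> inv\<^bsub>sym_group d\<^esub> g"
  have t: "?t \<in> carrier (sym_group d)" using g s' by (intro m_closed inv_closed)
  have "?t \<otimes>\<^bsub>sym_group d\<^esub> g = g \<otimes>\<^bsub>sym_group d\<^esub> s"
    using g s' by (simp add: m_assoc del: sym_group_inv_equality)
  then have "c (a g x) ?t * c x g = c x (g \<otimes>\<^bsub>sym_group d\<^esub> s)"
    by (simp only: flip: cocycle[OF x t g])
  also have "\<dots> = c x s * c x g"
    by (simp only: cocycle[OF x g s'(1)] s'(2) mult.commute)
  finally show ?thesis using nonzero[OF x g] by simp
qed

text \<open>Conjugation by \<open>g\<close> matches the two stabilizers and preserves the cocycle.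
  In the application \<open>P\<close> is a coefficient of the power sum product.\<close>

lemma stabilizer_sum_invariant:
  assumes x: "x \<in> E" and g: "g \<in> carrier (sym_group d)"
    and P: "\<And>s. s \<in> carrier (sym_group d) \<Longrightarrow>
      P (g \<otimes>\<^bsub>sym_group d\<^esub> s \<otimes>\<^bsub>sym_group d\<^esub> inv\<^bsub>sym_group d\<^esub> g) = P s"
  shows "(\<Sum>s\<in>stabilizer (sym_group d) a (a g x). c (a g x) s * P s)
    = (\<Sum>s\<in>stabilizer (sym_group d) a x. c x s * P s)"
proof -
  have gx: "a g x \<in> E" using element_image[OF g x] by simp
  have inv_gx: "a (inv\<^bsub>sym_group d\<^esub> g) (a g x) = x" using orbit_sym_aux[OF g x] by simp
  let ?conj = "\<lambda>s. g \<otimes>\<^bsub>sym_group d\<^esub> s \<otimes>\<^bsub>sym_group d\<^esub> inv\<^bsub>sym_group d\<^esub> g"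
  let ?conj' = "\<lambda>s. inv\<^bsub>sym_group d\<^esub> g \<otimes>\<^bsub>sym_group d\<^esub> s \<otimes>\<^bsub>sym_group d\<^esub> g"
  have carr: "s \<in> carrier (sym_group d)" if "s \<in> stabilizer (sym_group d) a y" for s y
    using that by (simp add: stabilizer_def)
  have conj_in: "?conj s \<in> stabilizer (sym_group d) a (a g x)"
    if "s \<in> stabilizer (sym_group d) a x" for s
    using stabilizer_conj[OF gx inv_closed[OF g], of s] that
    unfolding inv_gx inv_inv[OF g] by blast
  show ?thesis
  proof (rule sum.reindex_bij_witness[of _ ?conj ?conj'])
    fix s assume s: "s \<in> stabilizer (sym_group d) a (a g x)"
    show conj_s: "?conj (?conj' s) = s" by (rule conjugation_is_surj[OF g carr[OF s]])
    show s': "?conj' s \<in> stabilizer (sym_group d) a x" by (rule stabilizer_conj[OF x g s])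
    show "c x (?conj' s) * P (?conj' s) = c (a g x) s * P s"
      using cocycle_conj[OF x g s'] P[OF carr[OF s']] unfolding conj_s by simp
  next
    fix s assume s: "s \<in> stabilizer (sym_group d) a x"
    show "?conj' (?conj s) = s"
      using conjugation_is_surj[OF inv_closed[OF g] carr[OF s]] unfolding inv_inv[OF g] .
    show "?conj s \<in> stabilizer (sym_group d) a (a g x)" by (rule conj_in[OF s])
  qed
qed

text \<open>Exchanging sums gives, for each point, a sum over its stabilizer that is constant on
  orbits. The size of an orbit is \<open>d!\<close> divided by the order of the stabilizer, which
  turns the factor \<open>1 / d!\<close> of \<open>ch\<close> into the normalizing factor of the
  cycle index.\<close>

lemma ch_monomial_char:
  assumes T: "T \<subseteq> E" and reps: "\<forall>Q\<in>orbits (sym_group d) E a. \<exists>!x. x \<in> T \<and> x \<in> Q"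
  shows "ch d monomial_char
    = (\<Sum>x\<in>T. cycle_index d (stabilizer (sym_group d) a x) (c x) power_sum)"
proof (rule mseries_eqI)
  fix M
  let ?G = "carrier (sym_group d)" and ?stab = "stabilizer (sym_group d) a"
  let ?P = "\<lambda>\<sigma>. coeff_of (power_sum_monomial d \<sigma> :: 'k mseries) M"
  define F where "F x = (\<Sum>\<sigma>\<in>?stab x. c x \<sigma> * ?P \<sigma>)" for x
  have F_inv: "F (a g x) = F x" if "g \<in> ?G" "x \<in> E" for g x
    unfolding F_def
    by (rule stabilizer_sum_invariant[OF that(2,1)]) (simp only: power_sum_monomial_conj[OF that(1)])
  have card: "of_nat (card (Group_Action.orbit (sym_group d) a x))
      = (of_nat (fact d) / of_nat (card (?stab x)) :: 'k)" if "x \<in> E" for x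
  proof -
    have "card (Group_Action.orbit (sym_group d) a x) * card (?stab x) = fact d"
      using orbit_stabilizer_theorem[OF that] by (simp only: order_sym_group)
    then have "of_nat (card (Group_Action.orbit (sym_group d) a x)) * of_nat (card (?stab x))
        = (of_nat (fact d) :: 'k)"
      by (simp only: flip: of_nat_mult)
    \<comment> \<open>The product of both cardinalities is \<open>d!\<close>, which is nonzero in
      characteristic zero.\<close>
    moreover from this have "of_nat (card (?stab x)) \<noteq> (0 :: 'k)"
      by (metis fact_nonzero mult_zero_right of_nat_fact)
    ultimately show ?thesis by (simp add: eq_divide_eq)
  qed
  have "(\<Sum>\<sigma>\<in>?G. monomial_char \<sigma> * ?P \<sigma>)
      = (\<Sum>\<sigma>\<in>?G. \<Sum>x\<in>E. if a \<sigma> x = x then c x \<sigma> * ?P \<sigma> else 0)"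
    by (intro sum.cong refl) (simp add: monomial_char_def sum_distrib_right if_distrib[of "\<lambda>y. y * _"] cong: if_cong)
  also have "\<dots> = (\<Sum>x\<in>E. F x)"
    unfolding F_def stabilizer_def using finite_sym_group[of d]
    by (subst sum.swap) (simp flip: sum.inter_filter)
  also have "\<dots> = (\<Sum>x\<in>T. of_nat (card (Group_Action.orbit (sym_group d) a x)) * F x)"
    by (rule sum_eq_sum_representatives[OF finite_points T reps F_inv])
  also have "\<dots> = of_nat (fact d) * (\<Sum>x\<in>T. 1 / of_nat (card (?stab x)) * F x)"
    using T card by (simp add: sum_distrib_left subset_iff)
  finally show "coeff_of (ch d monomial_char) M
      = coeff_of (\<Sum>x\<in>T. cycle_index d (?stab x) (c x) power_sum) M"
    by (simp add: ch_def cycle_index_def F_def)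
qed

lemma monomial_char_in_characters: "monomial_char \<in> characters d"
proof -
  let ?G = "carrier (sym_group d)"
  define n where "n = card E"
  obtain f where f: "bij_betw f {0..<n} E"
    using ex_bij_betw_nat_finite[OF finite_points] unfolding n_def by blast
  have f_in: "f i \<in> E" if "i < n" for i using f that by (auto simp: bij_betw_def)
  have f_eq: "f i = f j \<longleftrightarrow> i = j" if "i < n" "j < n" for i j
    using f that by (auto simp: bij_betw_def inj_on_def)
  define \<rho> where "\<rho> g = mat n n (\<lambda>(i, j). if a g (f j) = f i then c (f j) g else 0)" for g
  have \<rho>_mult: "\<rho> (g \<otimes>\<^bsub>sym_group d\<^esub> h) = \<rho> g * \<rho> h" if g: "g \<in> ?G" and h: "h \<in> ?G" for g h
  proof (rule eq_matI)
    fix i j assume "i < dim_row (\<rho> g * \<rho> h)" "j < dim_col (\<rho> g * \<rho> h)"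
    then have i: "i < n" and j: "j < n" by (simp_all add: \<rho>_def)
    \<comment> \<open>The only nonzero entry of column \<open>j\<close> of \<open>\<rho> h\<close>
      is in the row \<open>l\<close> of the image point, so the matrix product collapses to one
      term.\<close>
    have "a h (f j) \<in> E" using element_image[OF h f_in[OF j]] by simp
    then obtain l where l: "l < n" "a h (f j) = f l"
      using f unfolding bij_betw_def by (metis atLeastLessThan_iff imageE)
    have "(\<rho> g * \<rho> h) $$ (i, j) = (\<Sum>k = 0..<n. \<rho> g $$ (i, k) * \<rho> h $$ (k, j))"
      using i j by (simp add: \<rho>_def scalar_prod_def)
    also have "\<dots> = (\<Sum>k = 0..<n. if k = l then \<rho> g $$ (i, l) * c (f j) h else 0)"
      using j l f_eq by (intro sum.cong refl) (auto simp: \<rho>_def)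
    also have "\<dots> = \<rho> g $$ (i, l) * c (f j) h" using l by simp
    also have "\<dots> = \<rho> (g \<otimes>\<^bsub>sym_group d\<^esub> h) $$ (i, j)"
      using i j l composition_rule[OF f_in[OF j] g h] cocycle[OF f_in[OF j] g h]
      by (simp add: \<rho>_def)
    finally show "\<rho> (g \<otimes>\<^bsub>sym_group d\<^esub> h) $$ (i, j) = (\<rho> g * \<rho> h) $$ (i, j)" by simp
  qed (simp_all add: \<rho>_def)
  have \<rho>_one: "\<rho> \<one>\<^bsub>sym_group d\<^esub> = 1\<^sub>m n"
    using f_in f_eq by (intro eq_matI) (auto simp: \<rho>_def action_one cocycle_one)
  have \<rho>_carrier: "\<rho> g \<in> carrier_mat n n" for g by (simp add: \<rho>_def)
  have "\<rho> \<in> hom (sym_group d) (units_of (ring_mat TYPE('k) n ()))"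
  proof (rule homI)
    fix g assume g: "g \<in> ?G"
    have "\<rho> (inv\<^bsub>sym_group d\<^esub> g) * \<rho> g = 1\<^sub>m n" "\<rho> g * \<rho> (inv\<^bsub>sym_group d\<^esub> g) = 1\<^sub>m n"
      by (simp_all only: g inv_closed l_inv r_inv \<rho>_one flip: \<rho>_mult)
    then show "\<rho> g \<in> carrier (units_of (ring_mat TYPE('k) n ()))"
      using \<rho>_carrier unfolding units_of_carrier Units_def ring_mat_simps by blast
  next
    fix g h assume "g \<in> ?G" "h \<in> ?G"
    then show "\<rho> (g \<otimes>\<^bsub>sym_group d\<^esub> h) = \<rho> g \<otimes>\<^bsub>units_of (ring_mat TYPE('k) n ())\<^esub> \<rho> h"
      by (simp only: \<rho>_mult units_of_mult ring_mat_simps)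
  qed
  moreover have "mat_trace (\<rho> g) = (\<Sum>x\<in>E. if a g x = x then c x g else 0)" for g
    using sum.reindex_bij_betw[OF f, of "\<lambda>x. if a g x = x then c x g else 0"]
    by (simp add: mat_trace_def \<rho>_def lessThan_atLeast0)
  ultimately show ?thesis
    unfolding characters_def monomial_char_def mem_Collect_eq
    by (intro exI[of _ \<rho>] exI[of _ n]) (simp add: fun_eq_iff)
qed

end

section \<open>The internal product on characters\<close>

text \<open>The zero function is the character of the representation of degree 0. Subtracting it
  shows that characters are generalized characters.\<close>

lemma zero_in_characters: "(\<lambda>\<sigma>\<in>carrier (sym_group d). 0 :: 'k::field) \<in> characters d"
proof -
  have "(\<lambda>_. 1\<^sub>m 0) \<in> hom (sym_group d) (units_of (ring_mat TYPE('k) 0 ()))"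
    by (intro homI) (auto simp: units_of_def ring_mat_simps Units_def)
  moreover have "mat_trace (1\<^sub>m 0 :: 'k mat) = 0" by (simp add: mat_trace_def)
  ultimately show ?thesis
    unfolding characters_def mem_Collect_eq
    by (intro exI[of _ "\<lambda>_. 1\<^sub>m 0"] exI[of _ 0]) simp
qed

lemma characters_subset_gen_characters: "characters d \<subseteq> (gen_characters d :: (_ \<Rightarrow> 'k::field) set)"
proof
  fix u :: "_ \<Rightarrow> 'k" assume u: "u \<in> characters d"
  then have "u = (\<lambda>\<sigma>\<in>carrier (sym_group d). u \<sigma> - (\<lambda>\<sigma>\<in>carrier (sym_group d). 0) \<sigma>)"
    by (auto simp: characters_def fun_eq_iff)
  then show "u \<in> gen_characters d"
    using u zero_in_characters unfolding gen_characters_def by blast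
qed

lemma internal_prod_ch:
  fixes u v :: "_ \<Rightarrow> 'k::field_char_0"
  assumes "u \<in> characters d" "v \<in> characters d"
  shows "internal_prod d (ch d u) (ch d v) = ch d (\<lambda>\<sigma>\<in>carrier (sym_group d). u \<sigma> * v \<sigma>)"
proof -
  have "the_inv_into (gen_characters d) (ch d) (ch d w) = w" if "w \<in> characters d" for w :: "_ \<Rightarrow> 'k"
    using that characters_subset_gen_characters by (intro the_inv_into_f_f[OF inj_on_ch]) blast
  then show ?thesis using assms by (simp add: internal_prod_def)
qed

section \<open>Products of monomial representations\<close>

text \<open>This is the tensor product: its basis vectors are indexed by tuples of points, and
  scalars multiply.\<close>

lemma monomial_rep_PiE:
  fixes c :: "'i \<Rightarrow> 'x \<Rightarrow> (nat \<Rightarrow> nat) \<Rightarrow> 'k::field_char_0"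
  assumes A: "finite A" and rep: "\<And>m. m \<in> A \<Longrightarrow> monomial_rep d (E m) (a m) (c m)"
  shows "monomial_rep d (\<Pi>\<^sub>E m\<in>A. E m) (\<lambda>\<zeta>. \<lambda>\<omega>\<in>\<Pi>\<^sub>E m\<in>A. E m. \<lambda>m\<in>A. a m \<zeta> (\<omega> m))
    (\<lambda>\<omega> \<zeta>. \<Prod>m\<in>A. c m (\<omega> m) \<zeta>)"
proof (rule monomial_rep.intro)
  let ?E = "\<Pi>\<^sub>E m\<in>A. E m"
  let ?a = "\<lambda>\<zeta>. \<lambda>\<omega>\<in>?E. \<lambda>m\<in>A. a m \<zeta> (\<omega> m)"
  interpret group "sym_group d" by (rule sym_group_is_group)
  have act: "group_action (sym_group d) (E m) (a m)" if "m \<in> A" for m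
    using monomial_rep.action[OF rep[OF that]] .
  have closed: "?a g \<omega> \<in> ?E" if "g \<in> carrier (sym_group d)" "\<omega> \<in> ?E" for g \<omega>
    using that group_action.element_image[OF act] by (auto simp: PiE_iff)
  show action: "group_action (sym_group d) ?E ?a"
  proof (rule group_actionI)
    fix \<omega> assume \<omega>: "\<omega> \<in> ?E"
    show "?a \<one>\<^bsub>sym_group d\<^esub> \<omega> = \<omega>"
    proof (rule PiE_ext[OF closed[OF one_closed \<omega>] \<omega>])
      fix m assume m: "m \<in> A"
      show "?a \<one>\<^bsub>sym_group d\<^esub> \<omega> m = \<omega> m"
        using monomial_rep.action_one[OF rep[OF m] PiE_mem[OF \<omega> m]] \<omega> m by simp
    qed
    fix g h assume g: "g \<in> carrier (sym_group d)" and h: "h \<in> carrier (sym_group d)"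
    show "?a (g \<otimes>\<^bsub>sym_group d\<^esub> h) \<omega> = ?a g (?a h \<omega>)"
    proof (rule PiE_ext[OF closed[OF m_closed[OF g h] \<omega>] closed[OF g closed[OF h \<omega>]]])
      fix m assume m: "m \<in> A"
      show "?a (g \<otimes>\<^bsub>sym_group d\<^esub> h) \<omega> m = ?a g (?a h \<omega>) m"
        using group_action.composition_rule[OF act[OF m] PiE_mem[OF \<omega> m] g h] closed[OF h \<omega>] \<omega> m
        by simp
    qed
  qed (use closed in auto)
  show "finite ?E" using A monomial_rep.finite_points[OF rep] by (intro finite_PiE)
next
  fix \<omega> g assume \<omega>: "\<omega> \<in> (\<Pi>\<^sub>E m\<in>A. E m)" and g: "g \<in> carrier (sym_group d)"
  then show "(\<Prod>m\<in>A. c m (\<omega> m) g) \<noteq> 0"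
    using A monomial_rep.nonzero[OF rep] by (auto simp: PiE_iff)
  fix h assume h: "h \<in> carrier (sym_group d)"
  show "(\<Prod>m\<in>A. c m (\<omega> m) (g \<otimes>\<^bsub>sym_group d\<^esub> h))
      = (\<Prod>m\<in>A. c m ((\<lambda>\<omega>\<in>\<Pi>\<^sub>E m\<in>A. E m. \<lambda>m\<in>A. a m h (\<omega> m)) \<omega> m) g) * (\<Prod>m\<in>A. c m (\<omega> m) h)"
    unfolding prod.distrib[symmetric]
  proof (rule prod.cong[OF refl])
    fix m assume m: "m \<in> A"
    show "c m (\<omega> m) (g \<otimes>\<^bsub>sym_group d\<^esub> h)
        = c m ((\<lambda>\<omega>\<in>\<Pi>\<^sub>E m\<in>A. E m. \<lambda>m\<in>A. a m h (\<omega> m)) \<omega> m) g * c m (\<omega> m) h"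
      using monomial_rep.cocycle[OF rep[OF m] PiE_mem[OF \<omega> m] g h] \<omega> m by simp
  qed
qed

text \<open>A tuple is fixed exactly if all its components are, so its term is a product over the
  components; distributivity turns the sum over tuples into the product of the traces.\<close>

lemma monomial_char_PiE:
  fixes c :: "'i \<Rightarrow> 'x \<Rightarrow> (nat \<Rightarrow> nat) \<Rightarrow> 'k::field_char_0"
  assumes A: "finite A" and rep: "\<And>m. m \<in> A \<Longrightarrow> monomial_rep d (E m) (a m) (c m)"
  shows "monomial_rep.monomial_char d (\<Pi>\<^sub>E m\<in>A. E m)
      (\<lambda>\<zeta>. \<lambda>\<omega>\<in>\<Pi>\<^sub>E m\<in>A. E m. \<lambda>m\<in>A. a m \<zeta> (\<omega> m)) (\<lambda>\<omega> \<zeta>. \<Prod>m\<in>A. c m (\<omega> m) \<zeta>)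
    = (\<lambda>\<sigma>\<in>carrier (sym_group d). \<Prod>m\<in>A. monomial_rep.monomial_char d (E m) (a m) (c m) \<sigma>)"
    (is "monomial_rep.monomial_char d ?E ?a ?c = _")
proof (rule ext)
  fix \<sigma>
  interpret monomial_rep d ?E ?a ?c by (rule monomial_rep_PiE[OF A rep])
  show "monomial_char \<sigma>
    = (\<lambda>\<sigma>\<in>carrier (sym_group d). \<Prod>m\<in>A. monomial_rep.monomial_char d (E m) (a m) (c m) \<sigma>) \<sigma>"
  proof (cases "\<sigma> \<in> carrier (sym_group d)")
    case False
    then show ?thesis by (simp add: monomial_char_def)
  next
    case True
    have fixed: "?a \<sigma> \<omega> = \<omega> \<longleftrightarrow> (\<forall>m\<in>A. a m \<sigma> (\<omega> m) = \<omega> m)" if "\<omega> \<in> ?E" for \<omega>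
    proof -
      have "?a \<sigma> \<omega> \<in> ?E" using element_image[OF True that refl] .
      then have "?a \<sigma> \<omega> = \<omega> \<longleftrightarrow> (\<forall>m\<in>A. ?a \<sigma> \<omega> m = \<omega> m)"
        using PiE_ext[of "?a \<sigma> \<omega>" A E \<omega>] that by metis
      then show ?thesis using that by simp
    qed
    have "monomial_char \<sigma> = (\<Sum>\<omega>\<in>?E. if ?a \<sigma> \<omega> = \<omega> then ?c \<omega> \<sigma> else 0)"
      using True by (simp only: monomial_char_def restrict_apply')
    also have "\<dots> = (\<Sum>\<omega>\<in>?E. \<Prod>m\<in>A. if a m \<sigma> (\<omega> m) = \<omega> m then c m (\<omega> m) \<sigma> else 0)"
    proof (rule sum.cong[OF refl])
      fix \<omega> assume \<omega>: "\<omega> \<in> ?E"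
      show "(if ?a \<sigma> \<omega> = \<omega> then ?c \<omega> \<sigma> else 0)
          = (\<Prod>m\<in>A. if a m \<sigma> (\<omega> m) = \<omega> m then c m (\<omega> m) \<sigma> else 0)"
      proof (cases "\<forall>m\<in>A. a m \<sigma> (\<omega> m) = \<omega> m")
        case True
        then show ?thesis unfolding fixed[OF \<omega>] by simp
      next
        case False
        then have "(\<Prod>m\<in>A. if a m \<sigma> (\<omega> m) = \<omega> m then c m (\<omega> m) \<sigma> else 0) = 0"
          using A by (intro prod_zero) auto
        then show ?thesis unfolding fixed[OF \<omega>] using False by (simp only: if_False)
      qed
    qed
    also have "\<dots> = (\<Prod>m\<in>A. \<Sum>x\<in>E m. if a m \<sigma> x = x then c m x \<sigma> else 0)"
      using A monomial_rep.finite_points[OF rep] by (intro prod_sum_PiE[symmetric])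
    also have "\<dots> = (\<Prod>m\<in>A. monomial_rep.monomial_char d (E m) (a m) (c m) \<sigma>)"
      using True by (intro prod.cong refl) (simp add: monomial_rep.monomial_char_def[OF rep])
    finally show ?thesis using True by simp
  qed
qed

section \<open>Induced characters\<close>

text \<open>The induced representation in monomial form, with the transversal as index set of the
  basis.\<close>

locale induced_rep =
  fixes d :: nat and W I :: "(nat \<Rightarrow> nat) set" and \<chi> :: "(nat \<Rightarrow> nat) \<Rightarrow> 'k::field_char_0"
  assumes W: "subgroup W (sym_group d)"
    and \<chi>: "one_dim_char d W \<chi>"
    and I: "left_transversal d W I"
begin

sublocale group "sym_group d" by (rule sym_group_is_group)

abbreviation "G \<equiv> sym_group d"

text \<open>If \<open>\<zeta> i = j w\<close> with \<open>j\<close> in the transversal and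
  \<open>w\<close> in \<open>W\<close>, the scalar is \<open>\<chi> w\<close>.\<close>

definition cocyc :: "(nat \<Rightarrow> nat) \<Rightarrow> (nat \<Rightarrow> nat) \<Rightarrow> 'k" where
  "cocyc i \<zeta> = \<chi> (inv\<^bsub>G\<^esub> (coset_act d W I \<zeta> i) \<otimes>\<^bsub>G\<^esub> \<zeta> \<otimes>\<^bsub>G\<^esub> i)"

lemma I_carrier: "i \<in> I \<Longrightarrow> i \<in> carrier G"
  using I by (auto simp: left_transversal_def)

lemma W_carrier: "w \<in> W \<Longrightarrow> w \<in> carrier G"
  using subgroup.subset[OF W] by blast

lemma mem_l_coset_iff:
  assumes "i \<in> carrier G" "x \<in> carrier G"
  shows "i \<in> x <#\<^bsub>G\<^esub> W \<longleftrightarrow> inv\<^bsub>G\<^esub> i \<otimes>\<^bsub>G\<^esub> x \<in> W"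
proof
  assume "i \<in> x <#\<^bsub>G\<^esub> W"
  then obtain w where w: "w \<in> W" "i = x \<otimes>\<^bsub>G\<^esub> w" by (auto simp: l_coset_def)
  then have "inv\<^bsub>G\<^esub> i \<otimes>\<^bsub>G\<^esub> x = inv\<^bsub>G\<^esub> w"
    using assms W_carrier[OF w(1)] by (simp add: inv_mult_group m_assoc del: sym_group_inv_equality)
  then show "inv\<^bsub>G\<^esub> i \<otimes>\<^bsub>G\<^esub> x \<in> W" using subgroup.m_inv_closed[OF W w(1)] by simp
next
  assume w: "inv\<^bsub>G\<^esub> i \<otimes>\<^bsub>G\<^esub> x \<in> W"
  have "i = x \<otimes>\<^bsub>G\<^esub> inv\<^bsub>G\<^esub> (inv\<^bsub>G\<^esub> i \<otimes>\<^bsub>G\<^esub> x)"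
    using assms by (simp add: inv_mult_group m_assoc[symmetric] del: sym_group_inv_equality)
  then show "i \<in> x <#\<^bsub>G\<^esub> W" using subgroup.m_inv_closed[OF W w] unfolding l_coset_def by blast
qed

text \<open>The condition on \<open>j\<close> says that it lies in the left coset of
  \<open>\<zeta> i\<close>, which meets the transversal in exactly one point.\<close>

lemma coset_act_unique:
  assumes "i \<in> I" "\<zeta> \<in> carrier G"
  shows "\<exists>!j. j \<in> I \<and> inv\<^bsub>G\<^esub> j \<otimes>\<^bsub>G\<^esub> \<zeta> \<otimes>\<^bsub>G\<^esub> i \<in> W"
proof -
  have i: "i \<in> carrier G" using I_carrier assms by blast
  have "inv\<^bsub>G\<^esub> j \<otimes>\<^bsub>G\<^esub> \<zeta> \<otimes>\<^bsub>G\<^esub> i = inv\<^bsub>G\<^esub> j \<otimes>\<^bsub>G\<^esub> (\<zeta> \<otimes>\<^bsub>G\<^esub> i)" if "j \<in> I" for j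
    using I_carrier[OF that] assms i by (intro m_assoc inv_closed)
  then have "j \<in> I \<and> inv\<^bsub>G\<^esub> j \<otimes>\<^bsub>G\<^esub> \<zeta> \<otimes>\<^bsub>G\<^esub> i \<in> W \<longleftrightarrow> j \<in> I \<and> j \<in> (\<zeta> \<otimes>\<^bsub>G\<^esub> i) <#\<^bsub>G\<^esub> W" for j
    using mem_l_coset_iff[OF I_carrier m_closed[OF assms(2) i]] by auto
  moreover have "\<exists>!j. j \<in> I \<and> j \<in> (\<zeta> \<otimes>\<^bsub>G\<^esub> i) <#\<^bsub>G\<^esub> W"
    using I m_closed[OF assms(2) i] unfolding left_transversal_def by blast
  ultimately show ?thesis by simp
qed

lemma coset_act_props:
  assumes "i \<in> I" "\<zeta> \<in> carrier G"
  shows "coset_act d W I \<zeta> i \<in> I"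
    and "inv\<^bsub>G\<^esub> (coset_act d W I \<zeta> i) \<otimes>\<^bsub>G\<^esub> \<zeta> \<otimes>\<^bsub>G\<^esub> i \<in> W"
proof -
  have "coset_act d W I \<zeta> i = (THE j. j \<in> I \<and> inv\<^bsub>G\<^esub> j \<otimes>\<^bsub>G\<^esub> \<zeta> \<otimes>\<^bsub>G\<^esub> i \<in> W)"
    using assms(1) by (simp only: coset_act_def restrict_apply')
  with theI'[OF coset_act_unique[OF assms]]
  show "coset_act d W I \<zeta> i \<in> I" "inv\<^bsub>G\<^esub> (coset_act d W I \<zeta> i) \<otimes>\<^bsub>G\<^esub> \<zeta> \<otimes>\<^bsub>G\<^esub> i \<in> W"
    by simp_all
qed

lemma coset_act_eqI:
  assumes "i \<in> I" "\<zeta> \<in> carrier G" "j \<in> I" "inv\<^bsub>G\<^esub> j \<otimes>\<^bsub>G\<^esub> \<zeta> \<otimes>\<^bsub>G\<^esub> i \<in> W"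
  shows "coset_act d W I \<zeta> i = j"
  using coset_act_unique[OF assms(1,2)] coset_act_props[OF assms(1,2)] assms(3,4) by blast

text \<open>With \<open>k\<close> the image of \<open>i\<close> under \<open>h\<close> and
  \<open>j\<close> the image of \<open>k\<close> under \<open>g\<close>, both factors lie in
  \<open>W\<close>. This one identity therefore gives the action law and, after applying \<chi>, the
  cocycle equation.\<close>

lemma coset_step_mult:
  assumes "i \<in> I" "g \<in> carrier G" "h \<in> carrier G" "j \<in> I" "k \<in> I"
  shows "(inv\<^bsub>G\<^esub> j \<otimes>\<^bsub>G\<^esub> g \<otimes>\<^bsub>G\<^esub> k) \<otimes>\<^bsub>G\<^esub> (inv\<^bsub>G\<^esub> k \<otimes>\<^bsub>G\<^esub> h \<otimes>\<^bsub>G\<^esub> i)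
    = inv\<^bsub>G\<^esub> j \<otimes>\<^bsub>G\<^esub> (g \<otimes>\<^bsub>G\<^esub> h) \<otimes>\<^bsub>G\<^esub> i"
proof -
  have cancel: "k \<otimes>\<^bsub>G\<^esub> (inv\<^bsub>G\<^esub> k \<otimes>\<^bsub>G\<^esub> x) = x" if "x \<in> carrier G" for x
    using that I_carrier[OF assms(5)] by (simp add: m_assoc[symmetric] del: sym_group_inv_equality)
  show ?thesis
    using assms I_carrier by (simp add: m_assoc cancel del: sym_group_inv_equality)
qed

lemma coset_act_mult:
  assumes "i \<in> I" "g \<in> carrier G" "h \<in> carrier G"
  shows "coset_act d W I (g \<otimes>\<^bsub>G\<^esub> h) i = coset_act d W I g (coset_act d W I h i)"
proof (rule coset_act_eqI)
  note k = coset_act_props[OF assms(1,3)]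
  note j = coset_act_props[OF k(1) assms(2)]
  show "coset_act d W I g (coset_act d W I h i) \<in> I" by (rule j)
  show "inv\<^bsub>G\<^esub> (coset_act d W I g (coset_act d W I h i)) \<otimes>\<^bsub>G\<^esub> (g \<otimes>\<^bsub>G\<^esub> h) \<otimes>\<^bsub>G\<^esub> i \<in> W"
    using subgroup.m_closed[OF W j(2) k(2)] unfolding coset_step_mult[OF assms j(1) k(1)] .
qed (use assms in simp_all)

sublocale rep: monomial_rep d I "coset_act d W I" cocyc
proof (rule monomial_rep.intro)
  show "group_action G I (coset_act d W I)"
  proof (rule group_actionI)
    fix i assume i: "i \<in> I"
    then have "inv\<^bsub>G\<^esub> i \<otimes>\<^bsub>G\<^esub> \<one>\<^bsub>G\<^esub> \<otimes>\<^bsub>G\<^esub> i \<in> W"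
      using I_carrier[OF i] subgroup.one_closed[OF W] by (simp del: sym_group_inv_equality)
    then show "coset_act d W I \<one>\<^bsub>G\<^esub> i = i" using i by (intro coset_act_eqI one_closed)
  qed (use coset_act_props(1) coset_act_mult in \<open>auto simp: coset_act_def\<close>)
  show "finite I" using I_carrier finite_subset[OF _ finite_sym_group] by blast
next
  fix i g assume i: "i \<in> I" and g: "g \<in> carrier G"
  show "cocyc i g \<noteq> 0"
    using coset_act_props(2)[OF i g] \<chi> unfolding cocyc_def one_dim_char_def hom_mult_group_iff
    by simp
  fix h assume h: "h \<in> carrier G"
  note k = coset_act_props[OF i h]
  note j = coset_act_props[OF k(1) g]
  show "cocyc i (g \<otimes>\<^bsub>G\<^esub> h) = cocyc (coset_act d W I h i) g * cocyc i h"
    unfolding cocyc_def coset_act_mult[OF i g h] coset_step_mult[OF i g h j(1) k(1), symmetric]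
    using \<chi> j(2) k(2) unfolding one_dim_char_def hom_mult_group_iff by simp
qed

text \<open>The action on the transversal is transitive, so the orbit decomposition of
  \<open>ch\<close> has one summand. Taking the representative of the coset \<open>W\<close> makes
  the stabilizer equal to \<open>W\<close> and the cocycle equal to \<chi>.\<close>

lemma cycle_index_eq_ch: "cycle_index d W \<chi> power_sum = ch d rep.monomial_char"
proof -
  \<comment> \<open>This representative need not be the identity. It lies in \<open>W\<close>, so
    conjugation by it affects neither membership in \<open>W\<close> nor the values of
    \<chi>.\<close>
  obtain i where i: "i \<in> I" "i \<in> \<one>\<^bsub>G\<^esub> <#\<^bsub>G\<^esub> W"
    using I unfolding left_transversal_def by blast
  have i_carrier: "i \<in> carrier G" by (rule I_carrier[OF i(1)])
  have "inv\<^bsub>G\<^esub> i \<in> W"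
    using i(2) i_carrier unfolding mem_l_coset_iff[OF i_carrier one_closed]
    by (simp del: sym_group_inv_equality)
  then have i_W: "i \<in> W" using subgroup.m_inv_closed[OF W, of "inv\<^bsub>G\<^esub> i"] i_carrier by (simp del: sym_group_inv_equality)
  have reps: "\<forall>Q\<in>orbits G I (coset_act d W I). \<exists>!x. x \<in> {i} \<and> x \<in> Q"
  proof
    fix Q assume "Q \<in> orbits G I (coset_act d W I)"
    then obtain j where j: "j \<in> I" "Q = Group_Action.orbit G (coset_act d W I) j"
      by (auto simp: orbits_def)
    have j_carrier: "j \<in> carrier G" by (rule I_carrier[OF j(1)])
    let ?g = "i \<otimes>\<^bsub>G\<^esub> inv\<^bsub>G\<^esub> j"
    have g: "?g \<in> carrier G" using i_carrier j_carrier by (intro m_closed inv_closed)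
    have "inv\<^bsub>G\<^esub> i \<otimes>\<^bsub>G\<^esub> ?g \<otimes>\<^bsub>G\<^esub> j = \<one>\<^bsub>G\<^esub>"
      using i_carrier j_carrier by (simp add: m_assoc del: sym_group_inv_equality)
    then have "coset_act d W I ?g j = i"
      using subgroup.one_closed[OF W] by (intro coset_act_eqI[OF j(1) g i(1)]) simp
    then have "i \<in> Q" using g unfolding j(2) Group_Action.orbit_def mem_Collect_eq by metis
    then show "\<exists>!x. x \<in> {i} \<and> x \<in> Q" by blast
  qed
  have step_iff: "inv\<^bsub>G\<^esub> i \<otimes>\<^bsub>G\<^esub> g \<otimes>\<^bsub>G\<^esub> i \<in> W \<longleftrightarrow> g \<in> W" if g: "g \<in> carrier G" for g
  proof
    assume w: "inv\<^bsub>G\<^esub> i \<otimes>\<^bsub>G\<^esub> g \<otimes>\<^bsub>G\<^esub> i \<in> W"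
    show "g \<in> W"
      using subgroup.m_closed[OF W subgroup.m_closed[OF W i_W w] \<open>inv\<^bsub>G\<^esub> i \<in> W\<close>]
      unfolding conjugation_is_surj[OF i_carrier g] .
  next
    assume "g \<in> W"
    then show "inv\<^bsub>G\<^esub> i \<otimes>\<^bsub>G\<^esub> g \<otimes>\<^bsub>G\<^esub> i \<in> W"
      using \<open>inv\<^bsub>G\<^esub> i \<in> W\<close> i_W by (intro subgroup.m_closed[OF W])
  qed
  have fixed: "coset_act d W I g i = i \<longleftrightarrow> g \<in> W" if g: "g \<in> carrier G" for g
    using coset_act_eqI[OF i(1) g i(1)] coset_act_props(2)[OF i(1) g] step_iff[OF g] by auto
  then have stab: "stabilizer G (coset_act d W I) i = W"
    using W_carrier by (auto simp: stabilizer_def)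
  have "cocyc i w = \<chi> w" if w: "w \<in> W" for w
  proof -
    have in_W: "inv\<^bsub>G\<^esub> i \<otimes>\<^bsub>G\<^esub> w \<in> W"
      using \<open>inv\<^bsub>G\<^esub> i \<in> W\<close> w by (intro subgroup.m_closed[OF W])
    have mult: "\<chi> (x \<otimes>\<^bsub>G\<^esub> y) = \<chi> x * \<chi> y" if "x \<in> W" "y \<in> W" for x y
      using \<chi> that unfolding one_dim_char_def hom_mult_group_iff by simp
    have "cocyc i w = \<chi> (inv\<^bsub>G\<^esub> i \<otimes>\<^bsub>G\<^esub> w \<otimes>\<^bsub>G\<^esub> i)"
      unfolding cocyc_def using fixed[OF W_carrier[OF w]] w by simp
    also have "\<dots> = \<chi> i * \<chi> (inv\<^bsub>G\<^esub> i \<otimes>\<^bsub>G\<^esub> w)"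
      by (simp only: mult[OF in_W i_W] mult.commute)
    also have "\<dots> = \<chi> (i \<otimes>\<^bsub>G\<^esub> (inv\<^bsub>G\<^esub> i \<otimes>\<^bsub>G\<^esub> w))"
      by (simp only: mult[OF i_W in_W])
    also have "i \<otimes>\<^bsub>G\<^esub> (inv\<^bsub>G\<^esub> i \<otimes>\<^bsub>G\<^esub> w) = w"
      using i_carrier W_carrier[OF w] by (simp add: m_assoc[symmetric] del: sym_group_inv_equality)
    finally show ?thesis .
  qed
  then have "cycle_index d W \<chi> power_sum = cycle_index d W (cocyc i) power_sum"
    by (simp add: cycle_index_def)
  then show ?thesis
    using rep.ch_monomial_char[OF _ reps] i(1) stab by simp
qed

end

section \<open>Iterated internal products and the weighted inventory\<close>

text \<open>Each step of the fold inverts \<open>ch\<close> on the partial product obtained so far;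
  hence all partial products are required to be characters, not only the factors.\<close>

lemma foldl_internal_prod:
  fixes u :: "nat \<Rightarrow> (nat \<Rightarrow> nat) \<Rightarrow> 'k::field_char_0"
  assumes "\<And>m. m \<in> {1..k} \<Longrightarrow> u m \<in> characters d"
    and "\<And>j. j \<in> {1..k} \<Longrightarrow> (\<lambda>\<sigma>\<in>carrier (sym_group d). \<Prod>m = 1..j. u m \<sigma>) \<in> characters d"
    and "1 \<le> k"
  shows "foldl (internal_prod d) (ch d (u 1)) (map (\<lambda>m. ch d (u m)) [2..<Suc k])
    = ch d (\<lambda>\<sigma>\<in>carrier (sym_group d). \<Prod>m = 1..k. u m \<sigma>)"
  using assms(3,1,2)
proof (induction k rule: nat_induct_at_least)
  case base
  then show ?case by (simp add: ch_def)
next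
  case (Suc k)
  let ?p = "\<lambda>k. \<lambda>\<sigma>\<in>carrier (sym_group d). \<Prod>m = 1..k. u m \<sigma>"
  have IH: "foldl (internal_prod d) (ch d (u 1)) (map (\<lambda>m. ch d (u m)) [2..<Suc k]) = ch d (?p k)"
    using Suc.prems by (intro Suc.IH) auto
  have upt: "[2..<Suc (Suc k)] = [2..<Suc k] @ [Suc k]" using Suc.hyps by simp
  have p_char: "?p k \<in> characters d"
    by (rule Suc.prems(2)) (use Suc.hyps in simp)
  have u_char: "u (Suc k) \<in> characters d"
    by (rule Suc.prems(1)) simp
  have "foldl (internal_prod d) (ch d (u 1)) (map (\<lambda>m. ch d (u m)) [2..<Suc (Suc k)])
      = internal_prod d (ch d (?p k)) (ch d (u (Suc k)))"
    unfolding upt map_append foldl_append IH by simp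
  also have "\<dots> = ch d (\<lambda>\<sigma>\<in>carrier (sym_group d). ?p k \<sigma> * u (Suc k) \<sigma>)"
    by (rule internal_prod_ch[OF p_char u_char])
  also have "\<dots> = ch d (?p (Suc k))"
    using Suc.hyps by (simp add: ch_def)
  finally show ?case .
qed

theorem theorem4p1p2:
  fixes d k :: nat
    and W I :: "nat \<Rightarrow> (nat \<Rightarrow> nat) set"
    and \<chi> :: "nat \<Rightarrow> (nat \<Rightarrow> nat) \<Rightarrow> 'k :: {alg_closed_field, field_char_0}"
    and T :: "(nat \<Rightarrow> nat \<Rightarrow> nat) set"
  assumes "d \<ge> 1" and "k \<ge> 1"
    and "\<And>m. m \<in> {1..k} \<Longrightarrow> subgroup (W m) (sym_group d)"
    and "\<And>m. m \<in> {1..k} \<Longrightarrow> one_dim_char d (W m) (\<chi> m)"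
    and "\<And>m. m \<in> {1..k} \<Longrightarrow> left_transversal d (W m) (I m)"
    and "orbit_representatives d k W I T"
  shows "foldl (internal_prod d) (cycle_index d (W 1) (\<chi> 1) power_sum)
           (map (\<lambda>m. cycle_index d (W m) (\<chi> m) power_sum) [2..<Suc k])
       = weighted_inventory d (U_set d k W I \<chi> T)"
proof -
  let ?S = "carrier (sym_group d)"
  define a where "a m = coset_act d (W m) (I m)" for m
  define c where "c m = induced_rep.cocyc d (W m) (I m) (\<chi> m)" for m
  define u where "u m = monomial_rep.monomial_char d (I m) (a m) (c m)" for m
  have ind: "induced_rep d (W m) (I m) (\<chi> m)" if "m \<in> {1..k}" for m
    using assms(3-5) that by (simp add: induced_rep_def)
  have rep: "monomial_rep d (I m) (a m) (c m)" if "m \<in> {1..k}" for m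
  proof -
    interpret induced_rep d "W m" "I m" "\<chi> m" by (rule ind[OF that])
    show ?thesis unfolding a_def c_def by (rule rep.monomial_rep_axioms)
  qed
  have Z: "cycle_index d (W m) (\<chi> m) power_sum = ch d (u m)" if "m \<in> {1..k}" for m
    unfolding u_def a_def c_def by (rule induced_rep.cycle_index_eq_ch[OF ind[OF that]])
  \<comment> \<open>The products are formed for every initial segment \<open>1..j\<close>, since the
    fold needs the partial products to be characters; the case \<open>j = k\<close> carries the
    action of the theorem.\<close>
  let ?E = "\<lambda>j. \<Pi>\<^sub>E m\<in>{1..j}. I m"
  let ?a = "\<lambda>j \<zeta>. \<lambda>\<omega>\<in>?E j. \<lambda>m\<in>{1..j}. a m \<zeta> (\<omega> m)"
  let ?c = "\<lambda>j \<omega> \<zeta>. \<Prod>m = 1..j. c m (\<omega> m) \<zeta>"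
  have prod_rep: "monomial_rep d (?E j) (?a j) (?c j)" if "j \<in> {1..k}" for j
    using that by (intro monomial_rep_PiE rep) auto
  have prod_char: "monomial_rep.monomial_char d (?E j) (?a j) (?c j) = (\<lambda>\<sigma>\<in>?S. \<Prod>m = 1..j. u m \<sigma>)"
    if "j \<in> {1..k}" for j
    unfolding u_def using that by (intro monomial_char_PiE rep) auto
  have u_char: "u m \<in> characters d" if "m \<in> {1..k}" for m
    unfolding u_def by (rule monomial_rep.monomial_char_in_characters[OF rep[OF that]])
  have prod_in: "(\<lambda>\<sigma>\<in>?S. \<Prod>m = 1..j. u m \<sigma>) \<in> characters d" if "j \<in> {1..k}" for j
    using monomial_rep.monomial_char_in_characters[OF prod_rep[OF that]]
    unfolding prod_char[OF that] .
  have k: "k \<in> {1..k}" using assms(2) by simp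
  interpret rep: monomial_rep d "?E k" "?a k" "?c k" by (rule prod_rep[OF k])
  have act: "?a k = coset_tuple_act d k W I"
    by (intro ext) (simp add: coset_tuple_act_def coset_tuples_def a_def)
  have T: "T \<subseteq> ?E k"
    and reps: "\<forall>Q\<in>orbits (sym_group d) (?E k) (?a k). \<exists>!\<omega>. \<omega> \<in> T \<and> \<omega> \<in> Q"
    using assms(6) unfolding orbit_representatives_def coset_tuples_def act by blast+
  let ?stab = "stab d k W I" and ?\<psi> = "psi d k W I \<chi>"
  have stab: "stabilizer (sym_group d) (?a k) \<omega> = ?stab \<omega>" for \<omega>
    unfolding act stab_def ..
  have subgroup: "subgroup (?stab \<omega>) (sym_group d)" if "\<omega> \<in> T" for \<omega>
    using rep.stabilizer_subgroup[of \<omega>] T that unfolding stab by blast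
  \<comment> \<open>\<beta> is the product of the cocycles of the induced representations, and
    \<psi> is its restriction to the stabilizer.\<close>
  have \<psi>_eq: "?\<psi> \<omega> \<zeta> = ?c k \<omega> \<zeta>" if "\<zeta> \<in> ?stab \<omega>" for \<omega> \<zeta>
    unfolding psi_def beta_def c_def using that
    by (simp only: restrict_apply') (intro prod.cong refl, simp only: induced_rep.cocyc_def[OF ind])
  have char: "one_dim_char d (?stab \<omega>) (?\<psi> \<omega>)" if "\<omega> \<in> T" for \<omega>
  proof -
    have "one_dim_char d (?stab \<omega>) (?c k \<omega>)"
      using rep.one_dim_char_stabilizer[of \<omega>] T that unfolding stab by blast
    then show ?thesis
      using \<psi>_eq[of _ \<omega>] subgroup.m_closed[OF subgroup[OF that]]
      unfolding one_dim_char_def hom_mult_group_iff by simp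
  qed
  have "foldl (internal_prod d) (cycle_index d (W 1) (\<chi> 1) power_sum)
           (map (\<lambda>m. cycle_index d (W m) (\<chi> m) power_sum) [2..<Suc k])
      = foldl (internal_prod d) (ch d (u 1)) (map (\<lambda>m. ch d (u m)) [2..<Suc k])"
  proof -
    have "cycle_index d (W 1) (\<chi> 1) power_sum = ch d (u 1)" using assms(2) by (intro Z) simp
    moreover have "map (\<lambda>m. cycle_index d (W m) (\<chi> m) power_sum) [2..<Suc k]
        = map (\<lambda>m. ch d (u m)) [2..<Suc k]"
      by (intro map_cong refl Z) auto
    ultimately show ?thesis by (simp only:)
  qed
  also have "\<dots> = ch d (\<lambda>\<sigma>\<in>?S. \<Prod>m = 1..k. u m \<sigma>)"
    by (rule foldl_internal_prod[OF u_char prod_in assms(2)])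
  also have "\<dots> = ch d rep.monomial_char"
    unfolding prod_char[OF k] ..
  also have "\<dots> = (\<Sum>\<omega>\<in>T. cycle_index d (?stab \<omega>) (?c k \<omega>) power_sum)"
    using rep.ch_monomial_char[OF T reps] unfolding stab .
  also have "\<dots> = (\<Sum>\<omega>\<in>T. cycle_index d (?stab \<omega>) (?\<psi> \<omega>) power_sum)"
    by (simp add: cycle_index_def \<psi>_eq cong: sum.cong)
  also have "\<dots> = weighted_inventory d (U_set d k W I \<chi> T)"
  proof (rule mseries_eqI)
    fix M
    let ?J = "\<lambda>\<omega>. {Q \<in> J_orbits d (?stab \<omega>) (?\<psi> \<omega>). Q \<subseteq> tuples_of d M}"
    \<comment> \<open>Orbits are tagged with \<omega>, so an orbit occurring for several
      representatives is counted once for each.\<close>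
    let ?U = "SIGMA \<omega>:T. J_orbits d (?stab \<omega>) (?\<psi> \<omega>)"
    let ?w = "\<lambda>(\<omega> :: nat \<Rightarrow> nat \<Rightarrow> nat, Q). orbit_weight d Q :: 'k mseries"
    have fin_T: "finite T" using finite_subset[OF T rep.finite_points] .
    have fin_J: "finite (?J \<omega>)" for \<omega>
      by (rule finite_subset[of _ "Pow (tuples_of d M)"]) (auto simp: finite_tuples_of)
    have weight: "coeff_of (?w p) M = (if snd p \<subseteq> tuples_of d M then 1 else 0)" if "p \<in> ?U" for p
      using that coeff_orbit_weight[OF subgroup] J_orbits_subset by fastforce
    \<comment> \<open>The coefficients of the weights are 0 or 1, so the formal sum at
      \<open>M\<close> counts the tagged orbits of weight \<open>M\<close>, of which there are
      finitely many.\<close>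
    have support: "{p. p \<in> ?U \<and> coeff_of (?w p) M \<noteq> 0} = (SIGMA \<omega>:T. ?J \<omega>)"
      using weight by (auto split: if_splits)
    have "coeff_of (weighted_inventory d (U_set d k W I \<chi> T)) M
        = (\<Sum>p\<in>(SIGMA \<omega>:T. ?J \<omega>). coeff_of (?w p) M)"
      unfolding weighted_inventory_def formal_sum_def U_set_def coeff_of_Abs support ..
    also have "\<dots> = (\<Sum>p\<in>(SIGMA \<omega>:T. ?J \<omega>). 1)"
      by (intro sum.cong refl) (subst weight, auto)
    also have "\<dots> = (\<Sum>\<omega>\<in>T. of_nat (card (?J \<omega>)))"
      using fin_T fin_J by (simp add: card_SigmaI)
    also have "\<dots> = coeff_of (\<Sum>\<omega>\<in>T. cycle_index d (?stab \<omega>) (?\<psi> \<omega>) power_sum) M"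
      unfolding coeff_sum
      by (intro sum.cong refl) (simp only: coeff_cycle_index[OF subgroup char])
    finally show "coeff_of (\<Sum>\<omega>\<in>T. cycle_index d (?stab \<omega>) (?\<psi> \<omega>) power_sum) M
        = coeff_of (weighted_inventory d (U_set d k W I \<chi> T)) M" by simp
  qed
  finally show ?thesis .
qed

end
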